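(* Let $K$ be a field, $\mathcal{G}=(G^0,\mathcal{G}^1,r,s)$ an ultragraph, and $I$ a (two-sided) ideal of $L_K(\mathcal{G})$. Let $\mathcal{H}_I=\{A\in\mathcal{G}^0\mid p_A\in I\}$ and $S_I=\{v\in B_{\mathcal{H}_I}\mid p_v^{\mathcal{H}_I}\in I\}$. Then the following are equivalent: (1) $I$ is a graded ideal; (2) $I$ is generated by elements of the form $p_A-\sum_{e\in S}s_es_e^*$, where $A\in\mathcal{G}^0$ and $S$ is a finite subset of $\mathcal{G}^1$ consisting of edges with the same source vertex $v\in A$; (3) $I$ is generated by the subset $\{p_A\mid A\in\mathcal{H}_I\}\cup\{p_v^{\mathcal{H}_I}\mid v\in S_I\}$.
   Context: An ultragraph $\mathcal{G}=(G^0,\mathcal{G}^1,r,s)$ consists of a countable set $G^0$ of vertices, a countable set $\mathcal{G}^1$ of edges, and maps $s:\mathcal{G}^1\to G^0$, $r:\mathcal{G}^1\to\mathcal{P}(G^0)\setminus\{\varnothing\}$. A vertex $v$ is regular if $0<|s^{-1}(v)|<\infty$. $\mathcal{G}^0$ denotes the smallest subset of $\mathcal{P}(G^0)$ that contains $\{v\}$ for all $v\in G^0$, contains $r(e)$ for all $e\in\mathcal{G}^1$, and is closed under relative complements, finite unions and finite intersections. A finite path is either an element $A\in\mathcal{G}^0$ (of length $0$, with $s(A)=r(A)=A$) or a sequence $\alpha=\alpha_1\cdots\alpha_n$ of edges with $s(\alpha_{i+1})\in r(\alpha_i)$ for $1\le i\le n-1$ (of length $|\alpha|=n$). $\mathcal{G}^*$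 is the set of finite paths. For a field $K$, $L_K(\mathcal{G})$ is the (associative, not necessarily unital) $K$-algebra generated by $\{s_e,s_e^*\mid e\in\mathcal{G}^1\}\cup\{p_A\mid A\in\mathcal{G}^0\}$ subject to the relations, for all $A,B\in\mathcal{G}^0$, $e,f\in\mathcal{G}^1$: (1) $p_\varnothing=0$, $p_Ap_B=p_{A\cap B}$, $p_{A\cup B}=p_A+p_B-p_{A\cap B}$; (2) $p_{s(e)}s_e=s_e=s_ep_{r(e)}$ and $p_{r(e)}s_e^*=s_e^*=s_e^*p_{s(e)}$; (3) $s_e^*s_f=\delta_{e,f}p_{r(e)}$; (4) $p_v=\sum_{s(e)=v}s_es_e^*$ for every regular vertex $v$. Here $p_v:=p_{\{v\}}$; $s_A:=p_A=:s_A^*$ for $A\in\mathcal{G}^0$, and $s_\alpha:=s_{\alpha_1}\cdots s_{\alpha_n}$, $s_\alpha^*:=s_{\alpha_n}^*\cdots s_{\alpha_1}^*$ for $\alpha=\alpha_1\cdots\alpha_n$. $L_K(\mathcal{G})$ is $\mathbb{Z}$-graded with degree-$n$ component $\mathrm{Span}_K\{s_\alpha p_As_\beta^*\mid\alpha,\beta\in\mathcal{G}^*,A\in\mathcal{G}^0,|\alpha|-|\beta|=n\}$; graded ideals are with respect to this grading. For a subset $\mathcal{H}\subseteq\mathcal{G}^0$, $B_{\mathcal{H}}:=\{v\in G^0\mid |s^{-1}(v)|=\infty\text{ and }0<|s^{-1}(v)\cap\{e\mid r(e)\notin\mathcal{H}\}|<\infty\}$ (breaking vertices), and for $v\in B_{\mathcal{H}}$,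 $p_v^{\mathcal{H}}:=p_v-\sum_{e\in s^{-1}(v),\,r(e)\notin\mathcal{H}}s_es_e^*$. (The set $\mathcal{H}_I$ is always a saturated hereditary subset of $\mathcal{G}^0$.) *)

theory Defs
  imports "HOL-Algebra.QuotRing" "HOL-Algebra.Module" "HOL-Library.Poly_Mapping"
    "HOL-Library.Countable_Set"
begin

section \<open>Ultragraphs\<close>

record ('v, 'e) ultragraph =
  verts :: "'v set"
  edges :: "'e set"
  src   :: "'e \<Rightarrow> 'v"
  rng   :: "'e \<Rightarrow> 'v set"

locale ultragraph =
  fixes G :: "('v, 'e) ultragraph"
  assumes countable_verts: "countable (verts G)"
    and countable_edges: "countable (edges G)"
    and src_in_verts: "e \<in> edges G \<Longrightarrow> src G e \<in> verts G"
    and rng_subset_verts: "e \<in> edges G \<Longrightarrow> rng G e \<subseteq> verts G"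
    and rng_nonempty: "e \<in> edges G \<Longrightarrow> rng G e \<noteq> {}"

definition out_edges :: "('v, 'e) ultragraph \<Rightarrow> 'v \<Rightarrow> 'e set" where
  "out_edges G v = {e \<in> edges G. src G e = v}"

definition regular_vertex :: "('v, 'e) ultragraph \<Rightarrow> 'v \<Rightarrow> bool" where
  "regular_vertex G v \<longleftrightarrow> v \<in> verts G \<and> out_edges G v \<noteq> {} \<and> finite (out_edges G v)"

text \<open>
  The family \<open>\<G>\<^sup>0\<close>. The rule \<open>empty\<close> (the union of no sets) only matters when there are
  no vertices; otherwise it follows from \<open>single\<close> and \<open>diff\<close>.
\<close>

inductive_set gen_verts :: "('v, 'e) ultragraph \<Rightarrow> 'v set set" for G :: "('v, 'e) ultragraph" where
  empty:  "{} \<in> gen_verts G"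
| single: "v \<in> verts G \<Longrightarrow> {v} \<in> gen_verts G"
| range:  "e \<in> edges G \<Longrightarrow> rng G e \<in> gen_verts G"
| diff:   "A \<in> gen_verts G \<Longrightarrow> B \<in> gen_verts G \<Longrightarrow> A - B \<in> gen_verts G"
| union:  "A \<in> gen_verts G \<Longrightarrow> B \<in> gen_verts G \<Longrightarrow> A \<union> B \<in> gen_verts G"
| inter:  "A \<in> gen_verts G \<Longrightarrow> B \<in> gen_verts G \<Longrightarrow> A \<inter> B \<in> gen_verts G"

datatype ('v, 'e) path = SetPath "'v set" | EdgePath "'e list"

definition paths :: "('v, 'e) ultragraph \<Rightarrow> ('v, 'e) path set" where
  "paths G = SetPath ` gen_verts G \<union>
     {EdgePath \<alpha> | \<alpha>. \<alpha> \<noteq> [] \<and> set \<alpha> \<subseteq> edges G \<and>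
        (\<forall>i. Suc i < length \<alpha> \<longrightarrow> src G (\<alpha> ! Suc i) \<in> rng G (\<alpha> ! i))}"

fun path_length :: "('v, 'e) path \<Rightarrow> nat" where
  "path_length (SetPath A) = 0"
| "path_length (EdgePath \<alpha>) = length \<alpha>"


section \<open>Not necessarily unital algebras\<close>

text \<open>
  A \<open>'k\<close>-algebra is represented by a \<open>module\<close> record of HOL-Algebra, with the field of scalars a
  type of class \<^class>\<open>field\<close>. The algebras here need not have a unit; the
  record field for the unit is a dummy that nothing below refers to.
\<close>

definition lin_subspace :: "('k, 'a, 'm) module_scheme \<Rightarrow> 'a set \<Rightarrow> bool" where
  "lin_subspace L W \<longleftrightarrow> additive_subgroup W L \<and> (\<forall>c. \<forall>x\<in>W. c \<odot>\<^bsub>L\<^esub> x \<in> W)"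

definition lin_span :: "('k, 'a, 'm) module_scheme \<Rightarrow> 'a set \<Rightarrow> 'a set" where
  "lin_span L X = \<Inter>{W. lin_subspace L W \<and> X \<subseteq> W}"

definition alg_ideal :: "('k, 'a, 'm) module_scheme \<Rightarrow> 'a set \<Rightarrow> bool" where
  "alg_ideal L I \<longleftrightarrow> lin_subspace L I \<and>
     (\<forall>x\<in>carrier L. \<forall>a\<in>I. x \<otimes>\<^bsub>L\<^esub> a \<in> I \<and> a \<otimes>\<^bsub>L\<^esub> x \<in> I)"

definition ideal_gen :: "('k, 'a, 'm) module_scheme \<Rightarrow> 'a set \<Rightarrow> 'a set" where
  "ideal_gen L X = \<Inter>{I. alg_ideal L I \<and> X \<subseteq> I}"

definition alg_quot :: "('k, 'a, 'm) module_scheme \<Rightarrow> 'a set \<Rightarrow> ('k, 'a set) module" where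
  "alg_quot F J =
     \<lparr>carrier = a_rcosets\<^bsub>F\<^esub> J, mult = rcoset_mult F J, one = undefined,
      zero = J, add = set_add F, smult = (\<lambda>c X. \<Union>x\<in>X. J +>\<^bsub>F\<^esub> (c \<odot>\<^bsub>F\<^esub> x))\<rparr>"

text \<open>Product of a nonempty list; the first equation is a dummy.\<close>

fun mult_list :: "('a, 'm) ring_scheme \<Rightarrow> 'a list \<Rightarrow> 'a" where
  "mult_list L [] = \<zero>\<^bsub>L\<^esub>"
| "mult_list L [x] = x"
| "mult_list L (x # y # xs) = x \<otimes>\<^bsub>L\<^esub> mult_list L (y # xs)"


section \<open>Free algebras\<close>

text \<open>
  With lists as a monoid under concatenation, the convolution product of \<^type>\<open>poly_mapping\<close> makes
  the finitely supported functions from words to \<open>'k\<close> the free unital algebra. The free nonunital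
  algebra on \<open>X\<close> consists of those supported on nonempty words over \<open>X\<close>.
\<close>

instantiation list :: (type) monoid_add
begin
definition zero_list :: "'a list" where "zero_list = []"
definition plus_list :: "'a list \<Rightarrow> 'a list \<Rightarrow> 'a list" where "plus_list xs ys = xs @ ys"
instance by standard (simp_all add: zero_list_def plus_list_def)
end

definition free_alg :: "'g set \<Rightarrow> ('k::field, 'g list \<Rightarrow>\<^sub>0 'k) module" where
  "free_alg X =
     \<lparr>carrier = {f. \<forall>w\<in>Poly_Mapping.keys f. w \<noteq> [] \<and> set w \<subseteq> X}, mult = (*), one = undefined,
      zero = 0, add = (+), smult = (\<lambda>c. Poly_Mapping.map ((*) c))\<rparr>"

definition var :: "'g \<Rightarrow> ('g list \<Rightarrow>\<^sub>0 'k::field)" where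
  "var g = Poly_Mapping.single [g] 1"


section \<open>The Leavitt path algebra of an ultragraph\<close>

text \<open>Symbols for \<open>p\<^sub>A\<close>, \<open>s\<^sub>e\<close> and \<open>s\<^sub>e\<^sup>*\<close>, respectively.\<close>

datatype ('v, 'e) gen = Proj "'v set" | Edge 'e | Ghost 'e

type_synonym ('v, 'e, 'k) free_elem = "('v, 'e) gen list \<Rightarrow>\<^sub>0 'k"

type_synonym ('v, 'e, 'k) lpa_elem = "('v, 'e, 'k) free_elem set"

definition gens :: "('v, 'e) ultragraph \<Rightarrow> ('v, 'e) gen set" where
  "gens G = Proj ` gen_verts G \<union> Edge ` edges G \<union> Ghost ` edges G"

text \<open>A pair \<open>(x, y)\<close> stands for the defining relation \<open>x = y\<close>.\<close>

inductive_set lpa_rels ::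
    "('v, 'e) ultragraph \<Rightarrow> (('v, 'e, 'k::field) free_elem \<times> ('v, 'e, 'k) free_elem) set"
  for G :: "('v, 'e) ultragraph" where
  p_empty: "(var (Proj {}), 0) \<in> lpa_rels G"
| p_inter: "A \<in> gen_verts G \<Longrightarrow> B \<in> gen_verts G \<Longrightarrow>
    (var (Proj A) * var (Proj B), var (Proj (A \<inter> B))) \<in> lpa_rels G"
| p_union: "A \<in> gen_verts G \<Longrightarrow> B \<in> gen_verts G \<Longrightarrow>
    (var (Proj (A \<union> B)), var (Proj A) + var (Proj B) - var (Proj (A \<inter> B))) \<in> lpa_rels G"
| src_edge: "e \<in> edges G \<Longrightarrow> (var (Proj {src G e}) * var (Edge e), var (Edge e)) \<in> lpa_rels G"
| edge_rng: "e \<in> edges G \<Longrightarrow> (var (Edge e) * var (Proj (rng G e)), var (Edge e)) \<in> lpa_rels G"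
| rng_ghost: "e \<in> edges G \<Longrightarrow> (var (Proj (rng G e)) * var (Ghost e), var (Ghost e)) \<in> lpa_rels G"
| ghost_src: "e \<in> edges G \<Longrightarrow> (var (Ghost e) * var (Proj {src G e}), var (Ghost e)) \<in> lpa_rels G"
| ghost_edge: "e \<in> edges G \<Longrightarrow> f \<in> edges G \<Longrightarrow>
    (var (Ghost e) * var (Edge f), if e = f then var (Proj (rng G e)) else 0) \<in> lpa_rels G"
| regular: "regular_vertex G v \<Longrightarrow>
    (var (Proj {v}), \<Sum>e\<in>out_edges G v. var (Edge e) * var (Ghost e)) \<in> lpa_rels G"

definition lpa_kernel :: "('v, 'e) ultragraph \<Rightarrow> ('v, 'e, 'k::field) free_elem set" where
  "lpa_kernel G = ideal_gen (free_alg (gens G)) {x - y | x y. (x, y) \<in> lpa_rels G}"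

definition LPA :: "('v, 'e) ultragraph \<Rightarrow> ('k::field, ('v, 'e, 'k) lpa_elem) module" where
  "LPA G = alg_quot (free_alg (gens G)) (lpa_kernel G)"

definition lpa_gen :: "('v, 'e) ultragraph \<Rightarrow> ('v, 'e) gen \<Rightarrow> ('v, 'e, 'k::field) lpa_elem" where
  "lpa_gen G g =
     lpa_kernel G +>\<^bsub>(free_alg (gens G) :: ('k, ('v, 'e, 'k) free_elem) module)\<^esub> var g"

definition lpa_p :: "('v, 'e) ultragraph \<Rightarrow> 'v set \<Rightarrow> ('v, 'e, 'k::field) lpa_elem" where
  "lpa_p G A = lpa_gen G (Proj A)"

definition lpa_s :: "('v, 'e) ultragraph \<Rightarrow> 'e \<Rightarrow> ('v, 'e, 'k::field) lpa_elem" where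
  "lpa_s G e = lpa_gen G (Edge e)"

definition lpa_s_star :: "('v, 'e) ultragraph \<Rightarrow> 'e \<Rightarrow> ('v, 'e, 'k::field) lpa_elem" where
  "lpa_s_star G e = lpa_gen G (Ghost e)"

fun lpa_path :: "('v, 'e) ultragraph \<Rightarrow> ('v, 'e) path \<Rightarrow> ('v, 'e, 'k::field) lpa_elem" where
  "lpa_path G (SetPath A) = lpa_p G A"
| "lpa_path G (EdgePath \<alpha>) =
     mult_list (LPA G :: ('k, ('v, 'e, 'k) lpa_elem) module) (map (lpa_s G) \<alpha>)"

fun lpa_path_star :: "('v, 'e) ultragraph \<Rightarrow> ('v, 'e) path \<Rightarrow> ('v, 'e, 'k::field) lpa_elem" where
  "lpa_path_star G (SetPath A) = lpa_p G A"
| "lpa_path_star G (EdgePath \<alpha>) =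
     mult_list (LPA G :: ('k, ('v, 'e, 'k) lpa_elem) module) (map (lpa_s_star G) (rev \<alpha>))"

definition lpa_component :: "('v, 'e) ultragraph \<Rightarrow> int \<Rightarrow> ('v, 'e, 'k::field) lpa_elem set" where
  "lpa_component G n =
     (let L = (LPA G :: ('k, ('v, 'e, 'k) lpa_elem) module) in
      lin_span L {lpa_path G \<alpha> \<otimes>\<^bsub>L\<^esub> lpa_p G A \<otimes>\<^bsub>L\<^esub> lpa_path_star G \<beta> | \<alpha> A \<beta>.
        \<alpha> \<in> paths G \<and> \<beta> \<in> paths G \<and> A \<in> gen_verts G \<and>
        int (path_length \<alpha>) - int (path_length \<beta>) = n})"

text \<open>
  \<open>I = \<Oplus>\<^sub>n (I \<inter> L\<^sub>n)\<close>: every element of \<open>I\<close> is a finite sum of homogeneous elements of \<open>I\<close>. That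
  the sum of the \<open>I \<inter> L\<^sub>n\<close> is direct is inherited from \<open>L = \<Oplus>\<^sub>n L\<^sub>n\<close>.
\<close>

definition graded_ideal :: "('v, 'e) ultragraph \<Rightarrow> ('v, 'e, 'k::field) lpa_elem set \<Rightarrow> bool" where
  "graded_ideal G I \<longleftrightarrow>
     (let L = (LPA G :: ('k, ('v, 'e, 'k) lpa_elem) module) in
      alg_ideal L I \<and>
      (\<forall>x\<in>I. \<exists>N y. finite N \<and> (\<forall>n\<in>N. y n \<in> I \<inter> lpa_component G n) \<and> x = finsum L y N))"


section \<open>Generators of graded ideals\<close>

definition breaking :: "('v, 'e) ultragraph \<Rightarrow> 'v set set \<Rightarrow> 'v set" where
  "breaking G H = {v \<in> verts G. infinite (out_edges G v) \<and>
     {e \<in> out_edges G v. rng G e \<notin> H} \<noteq> {} \<and> finite {e \<in> out_edges G v. rng G e \<notin> H}}"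

text \<open>The element \<open>p\<^sub>A - \<Sum>\<^sub>e\<^sub>\<in>\<^sub>S s\<^sub>e s\<^sub>e\<^sup>*\<close> of the Leavitt path algebra.\<close>

definition lpa_gap :: "('v, 'e) ultragraph \<Rightarrow> 'v set \<Rightarrow> 'e set \<Rightarrow> ('v, 'e, 'k::field) lpa_elem" where
  "lpa_gap G A S =
     (let L = (LPA G :: ('k, ('v, 'e, 'k) lpa_elem) module) in
      lpa_p G A \<ominus>\<^bsub>L\<^esub> finsum L (\<lambda>e. lpa_s G e \<otimes>\<^bsub>L\<^esub> lpa_s_star G e) S)"

definition lpa_pH ::
    "('v, 'e) ultragraph \<Rightarrow> 'v set set \<Rightarrow> 'v \<Rightarrow> ('v, 'e, 'k::field) lpa_elem" where
  "lpa_pH G H v = lpa_gap G {v} {e \<in> out_edges G v. rng G e \<notin> H}"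

definition H_of :: "('v, 'e) ultragraph \<Rightarrow> ('v, 'e, 'k::field) lpa_elem set \<Rightarrow> 'v set set" where
  "H_of G I = {A \<in> gen_verts G. lpa_p G A \<in> I}"

definition S_of :: "('v, 'e) ultragraph \<Rightarrow> ('v, 'e, 'k::field) lpa_elem set \<Rightarrow> 'v set" where
  "S_of G I = {v \<in> breaking G (H_of G I). lpa_pH G (H_of G I) v \<in> I}"

end

theory Submission
  imports Defs
begin

text \<open>
  An ideal generated by homogeneous elements is graded; so the point is that a graded ideal \<open>I\<close> lies
  in the ideal \<open>J\<close> generated by the \<open>p\<^sub>A\<close> and \<open>p\<^sub>v\<^sup>H\<close> in \<open>I\<close>, where \<open>H = {A. p\<^sub>A \<in> I}\<close>.
  Write \<open>E\<^sub>F\<close> for the sum of the \<open>s\<^sub>e s\<^sub>e\<^sup>*\<close> over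
  \<open>e \<in> F\<close>. A homogeneous \<open>x \<in> I\<close> of positive degree equals \<open>E\<^sub>F x\<close> for a large finite \<open>F\<close>, and the
  \<open>s\<^sub>e\<^sup>* x \<in> I\<close> have smaller degree; negative degrees are symmetric. In degree zero, induct on the
  length of the paths: \<open>x = a + y\<close> with \<open>a\<close> a combination of the \<open>p\<^sub>A\<close> and \<open>y = E\<^sub>F y E\<^sub>F\<close>, where
  \<open>E\<^sub>F x E\<^sub>F \<in> J\<close> by induction, so that only \<open>x - E\<^sub>F x E\<^sub>F = a (1 - E\<^sub>F) \<in> I\<close> is left. Cutting it down to
  sets on which \<open>a\<close> is a scalar and then to single vertices leaves the elements
  \<open>p\<^sub>v (1 - E\<^sub>F) \<in> I\<close>. For these, \<open>p\<^bsub>r(e)\<^esub> \<in> I\<close> for all \<open>e \<notin> F\<close> with source \<open>v\<close>, so either no \<open>e\<close> with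
  source \<open>v\<close> has \<open>r(e) \<notin> H\<close> and \<open>p\<^sub>v \<in> I\<close>, or \<open>v\<close> is regular, or \<open>v\<close> is a breaking vertex and
  \<open>p\<^sub>v\<^sup>H \<in> I\<close>.
\<close>

section \<open>Algebra modulo a two-sided ideal\<close>

text \<open>In a unital ring, absorbing \<open>- 1\<close> already yields closure under negation;
  absorbing constants will likewise yield closure under scalars.\<close>

definition two_sided :: "'a::ring_1 set \<Rightarrow> bool" where
  "two_sided I \<longleftrightarrow> 0 \<in> I \<and> (\<forall>x\<in>I. \<forall>y\<in>I. x + y \<in> I) \<and> (\<forall>x. \<forall>a\<in>I. x * a \<in> I \<and> a * x \<in> I)"

context
  fixes I :: "'a::ring_1 set"
  assumes I: "two_sided I"
begin

lemma two_sided_zero: "0 \<in> I"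
  and two_sided_add: "x \<in> I \<Longrightarrow> y \<in> I \<Longrightarrow> x + y \<in> I"
  and two_sided_left: "x \<in> I \<Longrightarrow> z * x \<in> I"
  and two_sided_right: "x \<in> I \<Longrightarrow> x * z \<in> I"
  using I unfolding two_sided_def by blast+

lemma two_sided_uminus: "x \<in> I \<Longrightarrow> - x \<in> I"
  using two_sided_left[of x "- 1"] by simp

lemma two_sided_diff: "x \<in> I \<Longrightarrow> y \<in> I \<Longrightarrow> x - y \<in> I"
  using two_sided_add[of x "- y"] two_sided_uminus by simp

lemma two_sided_sum: "(\<And>i. i \<in> A \<Longrightarrow> f i \<in> I) \<Longrightarrow> sum f A \<in> I"
  by (induction A rule: infinite_finite_induct) (auto intro: two_sided_zero two_sided_add)

end

text \<open>Equality in the quotient by \<open>K\<close> is handled as a congruence between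
  representatives, so that all computations stay inside a type of class
  \<open>ring_1\<close>.\<close>

locale ring_mod =
  fixes K :: "'a::ring_1 set"
  assumes two_sided_K: "two_sided K"
begin

definition eqv :: "'a \<Rightarrow> 'a \<Rightarrow> bool" (infix "\<approx>" 50) where
  "x \<approx> y \<longleftrightarrow> x - y \<in> K"

lemma eqv_refl [simp, intro]: "x \<approx> x"
  using two_sided_zero[OF two_sided_K] by (simp add: eqv_def)

lemma eqv_sym: "x \<approx> y \<Longrightarrow> y \<approx> x"
  using two_sided_uminus[OF two_sided_K, of "x - y"] by (simp add: eqv_def)

lemma eqv_trans [trans]: "x \<approx> y \<Longrightarrow> y \<approx> z \<Longrightarrow> x \<approx> z"
  using two_sided_add[OF two_sided_K, of "x - y" "y - z"] by (simp add: eqv_def)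

lemma eqv_add: "a \<approx> b \<Longrightarrow> c \<approx> d \<Longrightarrow> a + c \<approx> b + d"
  using two_sided_add[OF two_sided_K, of "a - b" "c - d"] by (simp add: eqv_def algebra_simps)

lemma eqv_diff: "a \<approx> b \<Longrightarrow> c \<approx> d \<Longrightarrow> a - c \<approx> b - d"
  using two_sided_diff[OF two_sided_K, of "a - b" "c - d"] by (simp add: eqv_def algebra_simps)

lemma eqv_left: "a \<approx> b \<Longrightarrow> c * a \<approx> c * b"
  using two_sided_left[OF two_sided_K, of "a - b" c] by (simp add: eqv_def algebra_simps)

lemma eqv_right: "a \<approx> b \<Longrightarrow> a * c \<approx> b * c"
  using two_sided_right[OF two_sided_K, of "a - b" c] by (simp add: eqv_def algebra_simps)

lemma eqv_mult: "a \<approx> b \<Longrightarrow> c \<approx> d \<Longrightarrow> a * c \<approx> b * d"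
  by (meson eqv_left eqv_right eqv_trans)

lemma eqv_sum: "(\<And>i. i \<in> A \<Longrightarrow> f i \<approx> g i) \<Longrightarrow> sum f A \<approx> sum g A"
  by (induction A rule: infinite_finite_induct) (auto intro: eqv_add)

lemma eqv_zero_iff: "x \<approx> 0 \<longleftrightarrow> x \<in> K"
  by (simp add: eqv_def)

lemma eqv_mem: "two_sided I \<Longrightarrow> K \<subseteq> I \<Longrightarrow> x \<approx> y \<Longrightarrow> x \<in> I \<longleftrightarrow> y \<in> I"
  using two_sided_add[of I "x - y" y] two_sided_diff[of I x "x - y"] by (auto simp: eqv_def)

end


section \<open>The Leavitt relations modulo an ideal\<close>

text \<open>The generators live in a unital ring and satisfy the relations only modulo
  \<open>K\<close>. The ambient unit makes \<open>1 - edge_proj F\<close> available although the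
  Leavitt path algebra may have no unit. Scalars are the central elements
  \<open>scal c\<close>.\<close>

locale leavitt_mod = ultragraph G + ring_mod K
  for G :: "('v, 'e) ultragraph" and K :: "'a::ring_1 set" +
  fixes scal :: "'k::field \<Rightarrow> 'a" and p :: "'v set \<Rightarrow> 'a" and s t :: "'e \<Rightarrow> 'a"
  assumes scal_add: "scal (c + d) = scal c + scal d"
    and scal_mult: "scal (c * d) = scal c * scal d"
    and scal_1: "scal 1 = 1"
    and scal_comm: "x * scal c = scal c * x"
    and p_empty: "p {} \<approx> 0"
    and p_inter: "A \<in> gen_verts G \<Longrightarrow> B \<in> gen_verts G \<Longrightarrow> p A * p B \<approx> p (A \<inter> B)"
    and p_union: "A \<in> gen_verts G \<Longrightarrow> B \<in> gen_verts G \<Longrightarrow> p (A \<union> B) \<approx> p A + p B - p (A \<inter> B)"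
    and src_edge: "e \<in> edges G \<Longrightarrow> p {src G e} * s e \<approx> s e"
    and edge_rng: "e \<in> edges G \<Longrightarrow> s e * p (rng G e) \<approx> s e"
    and rng_ghost: "e \<in> edges G \<Longrightarrow> p (rng G e) * t e \<approx> t e"
    and ghost_src: "e \<in> edges G \<Longrightarrow> t e * p {src G e} \<approx> t e"
    and ghost_edge: "e \<in> edges G \<Longrightarrow> f \<in> edges G \<Longrightarrow> t e * s f \<approx> (if e = f then p (rng G e) else 0)"
    and regular: "regular_vertex G v \<Longrightarrow> p {v} \<approx> (\<Sum>e\<in>out_edges G v. s e * t e)"
begin

lemma scal_0: "scal 0 = 0"
  using scal_add[of 0 0] by simp

lemma src_gen: "e \<in> edges G \<Longrightarrow> {src G e} \<in> gen_verts G"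
  by (intro gen_verts.single src_in_verts)

declare gen_verts.intros [simp] src_gen [simp]

section \<open>Products of two generators\<close>

lemma p_s:
  assumes "A \<in> gen_verts G" "e \<in> edges G"
  shows "p A * s e \<approx> (if src G e \<in> A then s e else 0)"
proof -
  \<comment> \<open>With \<open>p {src G e}\<close> inserted, two projections meet: their
    intersection is the source vertex or empty.\<close>
  have "p A * s e \<approx> p A * (p {src G e} * s e)"
    by (intro eqv_left eqv_sym[OF src_edge] assms)
  also have "\<dots> = p A * p {src G e} * s e"
    by (simp add: mult.assoc)
  also have "\<dots> \<approx> p (A \<inter> {src G e}) * s e"
    by (intro eqv_right p_inter src_gen assms)
  also have "\<dots> \<approx> (if src G e \<in> A then s e else 0)"
    using src_edge[OF assms(2)] eqv_right[OF p_empty, of "s e"] by simp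
  finally show ?thesis .
qed

lemma t_p:
  assumes "A \<in> gen_verts G" "e \<in> edges G"
  shows "t e * p A \<approx> (if src G e \<in> A then t e else 0)"
proof -
  have "t e * p A \<approx> (t e * p {src G e}) * p A"
    by (intro eqv_right eqv_sym[OF ghost_src] assms)
  also have "\<dots> = t e * (p {src G e} * p A)"
    by (simp add: mult.assoc)
  also have "\<dots> \<approx> t e * p ({src G e} \<inter> A)"
    by (intro eqv_left p_inter src_gen assms)
  also have "\<dots> \<approx> (if src G e \<in> A then t e else 0)"
    using ghost_src[OF assms(2)] eqv_left[OF p_empty, of "t e"] by simp
  finally show ?thesis .
qed

text \<open>Inserting \<open>p (rng G e)\<close> between the factors kills \<open>s f\<close>, whose
  source lies outside that range.\<close>

lemma s_s_zero:
  assumes "e \<in> edges G" "f \<in> edges G" "src G f \<notin> rng G e"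
  shows "s e * s f \<approx> 0"
proof -
  have "s e * s f \<approx> (s e * p (rng G e)) * s f"
    by (intro eqv_right eqv_sym[OF edge_rng] assms)
  also have "\<dots> = s e * (p (rng G e) * s f)"
    by (simp add: mult.assoc)
  also have "\<dots> \<approx> s e * 0"
    using p_s[of "rng G e" f] assms by (intro eqv_left) auto
  finally show ?thesis by simp
qed

lemma t_t_zero:
  assumes "e \<in> edges G" "f \<in> edges G" "src G f \<notin> rng G e"
  shows "t f * t e \<approx> 0"
proof -
  have "t f * t e \<approx> t f * (p (rng G e) * t e)"
    by (intro eqv_left eqv_sym[OF rng_ghost] assms)
  also have "\<dots> = (t f * p (rng G e)) * t e"
    by (simp add: mult.assoc)
  also have "\<dots> \<approx> 0 * t e"
    using t_p[of "rng G e" f] assms by (intro eqv_right) auto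
  finally show ?thesis by simp
qed

text \<open>The ghost edges are multiplied in reverse order, so the heads of both lists are the
  outermost factors and cancel first against generators from either side. An empty list stands for
  an absent path.\<close>

definition mono :: "'e list \<Rightarrow> 'v set \<Rightarrow> 'e list \<Rightarrow> 'a" where
  "mono \<alpha> A \<beta> = prod_list (map s \<alpha>) * p A * prod_list (map t (rev \<beta>))"

lemma mono_Nil: "mono [] A [] = p A"
  and mono_Cons_left: "mono (e # \<alpha>) A \<beta> = s e * mono \<alpha> A \<beta>"
  and mono_Cons_right: "mono \<alpha> A (e # \<beta>) = mono \<alpha> A \<beta> * t e"
  by (simp_all add: mono_def mult.assoc)

section \<open>Monomials multiplied by a generator\<close>

lemma p_mono:
  assumes "A \<in> gen_verts G" "B \<in> gen_verts G" "set \<alpha> \<subseteq> edges G"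
  shows "p B * mono \<alpha> A \<beta> \<approx> 0 \<or>
    (\<exists>C\<in>gen_verts G. p B * mono \<alpha> A \<beta> \<approx> mono \<alpha> C \<beta>)"
proof (cases \<alpha>)
  case Nil
  have "p B * mono \<alpha> A \<beta> = (p B * p A) * prod_list (map t (rev \<beta>))"
    by (simp add: Nil mono_def mult.assoc)
  also have "\<dots> \<approx> p (B \<inter> A) * prod_list (map t (rev \<beta>))"
    by (intro eqv_right p_inter assms)
  also have "\<dots> = mono \<alpha> (B \<inter> A) \<beta>"
    by (simp add: Nil mono_def)
  finally show ?thesis using assms by auto
next
  case (Cons e \<gamma>)
  have "p B * mono \<alpha> A \<beta> = (p B * s e) * mono \<gamma> A \<beta>"
    by (simp add: Cons mono_Cons_left mult.assoc)
  also have "\<dots> \<approx> (if src G e \<in> B then s e else 0) * mono \<gamma> A \<beta>"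
    using assms Cons by (intro eqv_right p_s) auto
  also have "\<dots> = (if src G e \<in> B then mono \<alpha> A \<beta> else 0)"
    by (simp add: Cons mono_Cons_left)
  finally show ?thesis using assms by (auto split: if_splits)
qed

lemma mono_p:
  assumes "A \<in> gen_verts G" "B \<in> gen_verts G" "set \<beta> \<subseteq> edges G"
  shows "mono \<alpha> A \<beta> * p B \<approx> 0 \<or>
    (\<exists>C\<in>gen_verts G. mono \<alpha> A \<beta> * p B \<approx> mono \<alpha> C \<beta>)"
proof (cases \<beta>)
  case Nil
  have "mono \<alpha> A \<beta> * p B = prod_list (map s \<alpha>) * (p A * p B)"
    by (simp add: Nil mono_def mult.assoc)
  also have "\<dots> \<approx> prod_list (map s \<alpha>) * p (A \<inter> B)"
    by (intro eqv_left p_inter assms)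
  also have "\<dots> = mono \<alpha> (A \<inter> B) \<beta>"
    by (simp add: Nil mono_def)
  finally show ?thesis using assms by auto
next
  case (Cons e \<gamma>)
  have "mono \<alpha> A \<beta> * p B = mono \<alpha> A \<gamma> * (t e * p B)"
    by (simp add: Cons mono_Cons_right mult.assoc)
  also have "\<dots> \<approx> mono \<alpha> A \<gamma> * (if src G e \<in> B then t e else 0)"
    using assms Cons by (intro eqv_left t_p) auto
  also have "\<dots> = (if src G e \<in> B then mono \<alpha> A \<beta> else 0)"
    by (simp add: Cons mono_Cons_right)
  finally show ?thesis using assms by (auto split: if_splits)
qed

lemma t_mono_Cons:
  assumes "e \<in> edges G" "f \<in> edges G"
  shows "t e * mono (f # \<alpha>) A \<beta> \<approx> (if e = f then p (rng G e) * mono \<alpha> A \<beta> else 0)"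
proof -
  have "t e * mono (f # \<alpha>) A \<beta> = (t e * s f) * mono \<alpha> A \<beta>"
    by (simp add: mono_Cons_left mult.assoc)
  also have "\<dots> \<approx> (if e = f then p (rng G e) else 0) * mono \<alpha> A \<beta>"
    by (intro eqv_right ghost_edge assms)
  finally show ?thesis by (simp split: if_splits)
qed

lemma mono_Cons_s:
  assumes "e \<in> edges G" "f \<in> edges G"
  shows "mono \<alpha> A (f # \<beta>) * s e \<approx> (if e = f then mono \<alpha> A \<beta> * p (rng G e) else 0)"
proof -
  have "mono \<alpha> A (f # \<beta>) * s e = mono \<alpha> A \<beta> * (t f * s e)"
    by (simp add: mono_Cons_right mult.assoc)
  also have "\<dots> \<approx> mono \<alpha> A \<beta> * (if f = e then p (rng G f) else 0)"
    by (intro eqv_left ghost_edge assms)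
  finally show ?thesis by (simp split: if_splits)
qed

lemma t_mono_Nil:
  assumes "e \<in> edges G" "A \<in> gen_verts G"
  shows "t e * mono [] A \<beta> \<approx> (if src G e \<in> A then mono [] (rng G e) (\<beta> @ [e]) else 0)"
proof -
  let ?y = "prod_list (map t (rev \<beta>))"
  have "t e * mono [] A \<beta> = (t e * p A) * ?y"
    by (simp add: mono_def mult.assoc)
  also have "\<dots> \<approx> (if src G e \<in> A then t e else 0) * ?y"
    by (intro eqv_right t_p assms)
  \<comment> \<open>A factor \<open>p (rng G e)\<close> is supplied as the middle projection of the
    new monomial; the new ghost edge is innermost, hence last in the list.\<close>
  also have "\<dots> \<approx> (if src G e \<in> A then p (rng G e) * t e else 0) * ?y"
    using eqv_sym[OF rng_ghost[OF assms(1)]] by (intro eqv_right) auto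
  also have "\<dots> = (if src G e \<in> A then mono [] (rng G e) (\<beta> @ [e]) else 0)"
    by (simp add: mono_def mult.assoc)
  finally show ?thesis .
qed

lemma mono_Nil_s:
  assumes "e \<in> edges G" "A \<in> gen_verts G"
  shows "mono \<alpha> A [] * s e \<approx> (if src G e \<in> A then mono (\<alpha> @ [e]) (rng G e) [] else 0)"
proof -
  let ?y = "prod_list (map s \<alpha>)"
  have "mono \<alpha> A [] * s e = ?y * (p A * s e)"
    by (simp add: mono_def mult.assoc)
  also have "\<dots> \<approx> ?y * (if src G e \<in> A then s e else 0)"
    by (intro eqv_left p_s assms)
  also have "\<dots> \<approx> ?y * (if src G e \<in> A then s e * p (rng G e) else 0)"
    using eqv_sym[OF edge_rng[OF assms(1)]] by (intro eqv_left) auto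
  also have "\<dots> = (if src G e \<in> A then mono (\<alpha> @ [e]) (rng G e) [] else 0)"
    by (simp add: mono_def mult.assoc)
  finally show ?thesis .
qed

text \<open>
  The monomials are not required to be paths: a product along a non-path lies in \<open>K\<close> anyway.
\<close>

inductive_set mspan :: "(nat \<Rightarrow> nat \<Rightarrow> bool) \<Rightarrow> 'a set" for P :: "nat \<Rightarrow> nat \<Rightarrow> bool" where
  kernel: "x \<in> K \<Longrightarrow> x \<in> mspan P"
| mono: "A \<in> gen_verts G \<Longrightarrow> set \<alpha> \<subseteq> edges G \<Longrightarrow> set \<beta> \<subseteq> edges G \<Longrightarrow>
    P (length \<alpha>) (length \<beta>) \<Longrightarrow> scal c * mono \<alpha> A \<beta> \<in> mspan P"
| add: "x \<in> mspan P \<Longrightarrow> y \<in> mspan P \<Longrightarrow> x + y \<in> mspan P"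

lemma mspan_zero: "0 \<in> mspan P"
  by (intro mspan.kernel two_sided_zero two_sided_K)

lemma mspan_eqv: "x \<in> mspan P \<Longrightarrow> x \<approx> y \<Longrightarrow> y \<in> mspan P"
  using mspan.add[OF _ mspan.kernel, of x P "y - x"] eqv_sym[of x y] by (simp add: eqv_def)

lemma mspan_mono1:
  "A \<in> gen_verts G \<Longrightarrow> set \<alpha> \<subseteq> edges G \<Longrightarrow> set \<beta> \<subseteq> edges G \<Longrightarrow>
    P (length \<alpha>) (length \<beta>) \<Longrightarrow> mono \<alpha> A \<beta> \<in> mspan P"
  using mspan.mono[of A \<alpha> \<beta> P 1] by (simp add: scal_1)

lemma mspan_scal: "x \<in> mspan P \<Longrightarrow> scal c * x \<in> mspan P"
proof (induction rule: mspan.induct)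
  case (kernel x)
  then show ?case by (intro mspan.kernel two_sided_left[OF two_sided_K])
next
  case (mono A \<alpha> \<beta> d)
  then have "scal (c * d) * local.mono \<alpha> A \<beta> \<in> mspan P" by (intro mspan.mono)
  then show ?case by (simp add: scal_mult mult.assoc)
qed (simp add: distrib_left mspan.add)

text \<open>A linear map preserving \<open>K\<close> has to be checked on monomials only. One-sided
  multiplications and \<open>t e * x * s f\<close> are the maps treated this way.\<close>

lemma mspan_map:
  assumes "x \<in> mspan P"
    and add: "\<And>x y. h (x + y) = h x + h y"
    and scal: "\<And>c x. h (scal c * x) = scal c * h x"
    and K: "\<And>x. x \<in> K \<Longrightarrow> h x \<in> K"
    and mono: "\<And>A \<alpha> \<beta>. A \<in> gen_verts G \<Longrightarrow> set \<alpha> \<subseteq> edges G \<Longrightarrow> set \<beta> \<subseteq> edges G \<Longrightarrow>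
       P (length \<alpha>) (length \<beta>) \<Longrightarrow> h (mono \<alpha> A \<beta>) \<in> mspan Q"
  shows "h x \<in> mspan Q"
  using assms(1)
  by (induction rule: mspan.induct) (auto simp: scal add intro: mspan.kernel K mspan_scal mono mspan.add)

lemma scal_left_comm: "x * (scal c * y) = scal c * (x * y)"
  by (metis mult.assoc scal_comm)

lemma mspan_left:
  assumes "x \<in> mspan P"
    and "\<And>A \<alpha> \<beta>. A \<in> gen_verts G \<Longrightarrow> set \<alpha> \<subseteq> edges G \<Longrightarrow> set \<beta> \<subseteq> edges G \<Longrightarrow>
       P (length \<alpha>) (length \<beta>) \<Longrightarrow> z * mono \<alpha> A \<beta> \<in> mspan Q"
  shows "z * x \<in> mspan Q"
  using assms(1) by (rule mspan_map)
    (simp_all add: distrib_left scal_left_comm two_sided_left[OF two_sided_K] assms(2))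

lemma mspan_right:
  assumes "x \<in> mspan P"
    and "\<And>A \<alpha> \<beta>. A \<in> gen_verts G \<Longrightarrow> set \<alpha> \<subseteq> edges G \<Longrightarrow> set \<beta> \<subseteq> edges G \<Longrightarrow>
       P (length \<alpha>) (length \<beta>) \<Longrightarrow> mono \<alpha> A \<beta> * z \<in> mspan Q"
  shows "x * z \<in> mspan Q"
  using assms(1) by (rule mspan_map[where h = "\<lambda>x. x * z"])
    (simp_all add: distrib_right mult.assoc two_sided_right[OF two_sided_K] assms(2))

lemma mspan_p_left: "x \<in> mspan P \<Longrightarrow> B \<in> gen_verts G \<Longrightarrow> p B * x \<in> mspan P"
  by (erule mspan_left) (metis p_mono eqv_sym mspan_eqv mspan_zero mspan_mono1)

lemma mspan_p_right: "x \<in> mspan P \<Longrightarrow> B \<in> gen_verts G \<Longrightarrow> x * p B \<in> mspan P"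
  by (erule mspan_right) (metis mono_p eqv_sym mspan_eqv mspan_zero mspan_mono1)

section \<open>Generators shift the degree\<close>

abbreviation degree :: "int \<Rightarrow> nat \<Rightarrow> nat \<Rightarrow> bool" where
  "degree n \<equiv> \<lambda>a b. int a - int b = n"

lemma mspan_s_left:
  assumes "x \<in> mspan (degree n)" "e \<in> edges G"
  shows "s e * x \<in> mspan (degree (n + 1))"
  using assms(1) by (rule mspan_left) (use assms(2) in \<open>auto simp flip: mono_Cons_left intro!: mspan_mono1\<close>)

lemma mspan_t_right:
  assumes "x \<in> mspan (degree n)" "e \<in> edges G"
  shows "x * t e \<in> mspan (degree (n - 1))"
  using assms(1) by (rule mspan_right) (use assms(2) in \<open>auto simp flip: mono_Cons_right intro!: mspan_mono1\<close>)

text \<open>A ghost edge on the left either meets the head of \<open>\<alpha>\<close>, giving zero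
  or a cancellation, or, when \<open>\<alpha>\<close> is empty, gives zero or lengthens
  \<open>\<beta>\<close>. Every nonzero outcome lowers the degree by one.\<close>

lemma mspan_t_left:
  assumes "x \<in> mspan (degree n)" "e \<in> edges G"
  shows "t e * x \<in> mspan (degree (n - 1))"
  using assms(1)
proof (rule mspan_left)
  fix A \<alpha> \<beta>
  assume *: "A \<in> gen_verts G" "set \<alpha> \<subseteq> edges G" "set \<beta> \<subseteq> edges G" "degree n (length \<alpha>) (length \<beta>)"
  show "t e * mono \<alpha> A \<beta> \<in> mspan (degree (n - 1))"
  proof (cases \<alpha>)
    case Nil
    show ?thesis unfolding Nil using assms(2) * Nil
      by (intro mspan_eqv[OF _ eqv_sym[OF t_mono_Nil]]) (auto intro!: mspan_zero mspan_mono1)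
  next
    case (Cons f \<gamma>)
    show ?thesis unfolding Cons using assms(2) * Cons
      by (intro mspan_eqv[OF _ eqv_sym[OF t_mono_Cons]])
        (auto intro!: mspan_zero mspan_p_left mspan_mono1)
  qed
qed

lemma mspan_s_right:
  assumes "x \<in> mspan (degree n)" "e \<in> edges G"
  shows "x * s e \<in> mspan (degree (n + 1))"
  using assms(1)
proof (rule mspan_right)
  fix A \<alpha> \<beta>
  assume *: "A \<in> gen_verts G" "set \<alpha> \<subseteq> edges G" "set \<beta> \<subseteq> edges G" "degree n (length \<alpha>) (length \<beta>)"
  show "mono \<alpha> A \<beta> * s e \<in> mspan (degree (n + 1))"
  proof (cases \<beta>)
    case Nil
    show ?thesis unfolding Nil using assms(2) * Nil
      by (intro mspan_eqv[OF _ eqv_sym[OF mono_Nil_s]]) (auto intro!: mspan_zero mspan_mono1)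
  next
    case (Cons f \<gamma>)
    show ?thesis unfolding Cons using assms(2) * Cons
      by (intro mspan_eqv[OF _ eqv_sym[OF mono_Cons_s]])
        (auto intro!: mspan_zero mspan_p_right mspan_mono1)
  qed
qed

section \<open>The idempotents attached to finite sets of edges\<close>

definition edge_proj :: "'e set \<Rightarrow> 'a" where
  "edge_proj F = (\<Sum>e\<in>F. s e * t e)"

lemma edge_proj_s:
  assumes "finite F" "F \<subseteq> edges G" "f \<in> edges G"
  shows "edge_proj F * s f \<approx> (if f \<in> F then s f else 0)"
proof -
  have "edge_proj F * s f = (\<Sum>e\<in>F. s e * (t e * s f))"
    by (simp add: edge_proj_def sum_distrib_right mult.assoc)
  also have "\<dots> \<approx> (\<Sum>e\<in>F. s e * (if e = f then p (rng G e) else 0))"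
    using assms by (intro eqv_sum eqv_left ghost_edge) auto
  also have "\<dots> = (\<Sum>e\<in>F. if e = f then s e * p (rng G e) else 0)"
    by (intro sum.cong) auto
  also have "\<dots> = (if f \<in> F then s f * p (rng G f) else 0)"
    using assms(1) by simp
  also have "\<dots> \<approx> (if f \<in> F then s f else 0)"
    using edge_rng assms by auto
  finally show ?thesis .
qed

lemma t_edge_proj:
  assumes "finite F" "F \<subseteq> edges G" "f \<in> edges G"
  shows "t f * edge_proj F \<approx> (if f \<in> F then t f else 0)"
proof -
  have "t f * edge_proj F = (\<Sum>e\<in>F. (t f * s e) * t e)"
    by (simp add: edge_proj_def sum_distrib_left mult.assoc)
  also have "\<dots> \<approx> (\<Sum>e\<in>F. (if f = e then p (rng G f) else 0) * t e)"
    using assms by (intro eqv_sum eqv_right ghost_edge) auto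
  also have "\<dots> = (\<Sum>e\<in>F. if e = f then p (rng G e) * t e else 0)"
    by (intro sum.cong) auto
  also have "\<dots> = (if f \<in> F then p (rng G f) * t f else 0)"
    using assms(1) by simp
  also have "\<dots> \<approx> (if f \<in> F then t f else 0)"
    using rng_ghost assms by auto
  finally show ?thesis .
qed

lemma p_edge_proj:
  assumes "A \<in> gen_verts G" "F \<subseteq> edges G"
  shows "p A * edge_proj F \<approx> (\<Sum>e\<in>F. if src G e \<in> A then s e * t e else 0)"
proof -
  have "p A * edge_proj F = (\<Sum>e\<in>F. (p A * s e) * t e)"
    by (simp add: edge_proj_def sum_distrib_left mult.assoc)
  also have "\<dots> \<approx> (\<Sum>e\<in>F. (if src G e \<in> A then s e else 0) * t e)"
    using assms by (intro eqv_sum eqv_right p_s) auto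
  also have "\<dots> = (\<Sum>e\<in>F. if src G e \<in> A then s e * t e else 0)"
    by (intro sum.cong) auto
  finally show ?thesis .
qed

lemma edge_proj_p:
  assumes "A \<in> gen_verts G" "F \<subseteq> edges G"
  shows "edge_proj F * p A \<approx> (\<Sum>e\<in>F. if src G e \<in> A then s e * t e else 0)"
proof -
  have "edge_proj F * p A = (\<Sum>e\<in>F. s e * (t e * p A))"
    by (simp add: edge_proj_def sum_distrib_right mult.assoc)
  also have "\<dots> \<approx> (\<Sum>e\<in>F. s e * (if src G e \<in> A then t e else 0))"
    using assms by (intro eqv_sum eqv_left t_p) auto
  also have "\<dots> = (\<Sum>e\<in>F. if src G e \<in> A then s e * t e else 0)"
    by (intro sum.cong) auto
  finally show ?thesis .
qed

lemma edge_proj_idem: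
  assumes "finite F" "F \<subseteq> edges G"
  shows "edge_proj F * edge_proj F \<approx> edge_proj F"
proof -
  have "edge_proj F * edge_proj F = (\<Sum>e\<in>F. (edge_proj F * s e) * t e)"
    by (subst (2) edge_proj_def) (simp add: sum_distrib_left mult.assoc)
  also have "\<dots> \<approx> (\<Sum>e\<in>F. s e * t e)"
  proof (intro eqv_sum eqv_right)
    fix e assume "e \<in> F"
    then show "edge_proj F * s e \<approx> s e"
      using edge_proj_s[OF assms, of e] assms by auto
  qed
  finally show ?thesis by (simp add: edge_proj_def)
qed

text \<open>A monomial with nonempty \<open>\<alpha>\<close> starts with some \<open>s e\<close>,
  which is fixed as soon as \<open>e \<in> F\<close>. Stating this for all large finite
  \<open>F\<close> lets one \<open>F\<close> serve several summands, and both sides, at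
  once.\<close>

lemma edge_proj_fixes_left:
  assumes "x \<in> mspan P" and "\<And>a b. P a b \<Longrightarrow> a > 0"
  shows "\<forall>\<^sub>F F in finite_subsets_at_top (edges G). edge_proj F * x \<approx> x"
  using assms(1)
proof (induction rule: mspan.induct)
  case (kernel x)
  then have "edge_proj F * x \<approx> x" for F
    using two_sided_diff[OF two_sided_K two_sided_left[OF two_sided_K kernel] kernel] by (simp add: eqv_def)
  then show ?case by simp
next
  case (mono A \<alpha> \<beta> c)
  then obtain e \<gamma> where \<alpha>: "\<alpha> = e # \<gamma>"
    using assms(2) by (metis length_greater_0_conv neq_Nil_conv)
  have "edge_proj F * (scal c * local.mono \<alpha> A \<beta>) \<approx> scal c * local.mono \<alpha> A \<beta>"
    if "finite F" "{e} \<subseteq> F" "F \<subseteq> edges G" for F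
  proof -
    have "edge_proj F * (scal c * local.mono \<alpha> A \<beta>) = scal c * ((edge_proj F * s e) * local.mono \<gamma> A \<beta>)"
      by (simp add: \<alpha> mono_Cons_left scal_left_comm mult.assoc)
    also have "\<dots> \<approx> scal c * (s e * local.mono \<gamma> A \<beta>)"
      using edge_proj_s[of F e] that by (intro eqv_left eqv_right) auto
    finally show ?thesis by (simp add: \<alpha> mono_Cons_left)
  qed
  moreover have "finite {e}" "{e} \<subseteq> edges G" using mono \<alpha> by auto
  ultimately show ?case unfolding eventually_finite_subsets_at_top by blast
next
  case (add x y)
  from add.IH show ?case by eventually_elim (auto simp: distrib_left intro: eqv_add)
qed

lemma edge_proj_fixes_right:
  assumes "x \<in> mspan P" and "\<And>a b. P a b \<Longrightarrow> b > 0"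
  shows "\<forall>\<^sub>F F in finite_subsets_at_top (edges G). x * edge_proj F \<approx> x"
  using assms(1)
proof (induction rule: mspan.induct)
  case (kernel x)
  then have "x * edge_proj F \<approx> x" for F
    using two_sided_diff[OF two_sided_K two_sided_right[OF two_sided_K kernel] kernel] by (simp add: eqv_def)
  then show ?case by simp
next
  case (mono A \<alpha> \<beta> c)
  then obtain e \<gamma> where \<beta>: "\<beta> = e # \<gamma>"
    using assms(2) by (metis length_greater_0_conv neq_Nil_conv)
  have "(scal c * local.mono \<alpha> A \<beta>) * edge_proj F \<approx> scal c * local.mono \<alpha> A \<beta>"
    if "finite F" "{e} \<subseteq> F" "F \<subseteq> edges G" for F
  proof -
    have "(scal c * local.mono \<alpha> A \<beta>) * edge_proj F = scal c * (local.mono \<alpha> A \<gamma> * (t e * edge_proj F))"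
      by (simp add: \<beta> mono_Cons_right mult.assoc)
    also have "\<dots> \<approx> scal c * (local.mono \<alpha> A \<gamma> * t e)"
      using t_edge_proj[of F e] that by (intro eqv_left) auto
    finally show ?thesis by (simp add: \<beta> mono_Cons_right)
  qed
  moreover have "finite {e}" "{e} \<subseteq> edges G" using mono \<beta> by auto
  ultimately show ?case unfolding eventually_finite_subsets_at_top by blast
next
  case (add x y)
  from add.IH show ?case by eventually_elim (auto simp: distrib_right intro: eqv_add)
qed

lemma eventually_finite_edges_ex:
  assumes "\<forall>\<^sub>F F in finite_subsets_at_top (edges G). Q F"
  obtains F where "finite F" "F \<subseteq> edges G" "Q F"
  using assms unfolding eventually_finite_subsets_at_top by auto

lemma mspan_weaken:
  assumes "x \<in> mspan P" and "\<And>a b. P a b \<Longrightarrow> Q a b"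
  shows "x \<in> mspan Q"
  using assms(1) by (induction rule: mspan.induct) (auto intro: mspan.intros assms(2))

text \<open>The monomials of one chosen representation are sorted by \<open>Q\<close>; no uniqueness
  of the two parts is claimed.\<close>

lemma mspan_split:
  assumes "x \<in> mspan P"
  shows "\<exists>a\<in>mspan (\<lambda>i j. P i j \<and> Q i j). \<exists>y\<in>mspan (\<lambda>i j. P i j \<and> \<not> Q i j). x = a + y"
  using assms
proof (induction rule: mspan.induct)
  case (kernel x)
  then show ?case by (intro bexI[of _ x] bexI[of _ 0] mspan.kernel mspan_zero) auto
next
  case (mono A \<alpha> \<beta> c)
  show ?case
  proof (cases "Q (length \<alpha>) (length \<beta>)")
    case True
    then show ?thesis
      using mono by (intro bexI[of _ "scal c * local.mono \<alpha> A \<beta>"] bexI[of _ 0] mspan.mono mspan_zero) auto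
  next
    case False
    then show ?thesis
      using mono by (intro bexI[of _ 0] bexI[of _ "scal c * local.mono \<alpha> A \<beta>"] mspan.mono mspan_zero) auto
  qed
next
  case (add x x')
  then obtain a y a' y' where
    "a \<in> mspan (\<lambda>i j. P i j \<and> Q i j)" "y \<in> mspan (\<lambda>i j. P i j \<and> \<not> Q i j)" "x = a + y"
    "a' \<in> mspan (\<lambda>i j. P i j \<and> Q i j)" "y' \<in> mspan (\<lambda>i j. P i j \<and> \<not> Q i j)" "x' = a' + y'"
    by blast
  then show ?case
    by (intro bexI[of _ "a + a'"] bexI[of _ "y + y'"] mspan.add) (auto simp: algebra_simps)
qed

abbreviation diag :: "nat \<Rightarrow> nat \<Rightarrow> nat \<Rightarrow> bool" where
  "diag N \<equiv> \<lambda>a b. a = b \<and> a \<le> N"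

lemma mspan_degree_zero:
  assumes "x \<in> mspan (degree 0)"
  shows "\<exists>N. x \<in> mspan (diag N)"
  using assms
proof (induction rule: mspan.induct)
  case (mono A \<alpha> \<beta> c)
  then show ?case by (intro exI[of _ "length \<alpha>"] mspan.mono) auto
next
  case (add x y)
  then obtain M N where "x \<in> mspan (diag M)" "y \<in> mspan (diag N)" by blast
  then have "x \<in> mspan (diag (max M N))" "y \<in> mspan (diag (max M N))"
    by (auto elim!: mspan_weaken)
  then show ?case by (blast intro: mspan.add)
qed (auto intro: mspan.kernel)

text \<open>The outer edges on both sides cancel or give zero, and the range projections that appear
  are absorbed by the shorter monomial. A monomial \<open>p A\<close> yields zero or
  \<open>p (rng G e)\<close>, of length zero again, which respects any bound.\<close>

lemma mspan_t_s:
  assumes "x \<in> mspan (diag (Suc N))" "e \<in> edges G" "f \<in> edges G"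
  shows "t e * x * s f \<in> mspan (diag N)"
  using assms(1)
proof (rule mspan_map[where h = "\<lambda>x. t e * x * s f"])
  fix A \<alpha> \<beta>
  assume *: "A \<in> gen_verts G" "set \<alpha> \<subseteq> edges G" "set \<beta> \<subseteq> edges G"
    "length \<alpha> = length \<beta> \<and> length \<alpha> \<le> Suc N"
  have t_s: "t g * s h \<approx> (if g = h then p (rng G g) else 0)" if "g \<in> edges G" "h \<in> edges G" for g h
    using ghost_edge that by simp
  show "t e * mono \<alpha> A \<beta> * s f \<in> mspan (diag N)"
  proof (cases \<alpha>)
    case Nil
    then have "\<beta> = []" using * by simp
    have "t e * mono \<alpha> A \<beta> * s f = t e * p A * s f"
      by (simp add: Nil \<open>\<beta> = []\<close> mono_Nil)
    also have "\<dots> \<approx> (if src G e \<in> A then t e else 0) * s f"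
      by (intro eqv_right t_p assms *)
    also have "\<dots> = (if src G e \<in> A then t e * s f else 0)" by simp
    also have "\<dots> \<approx> (if src G e \<in> A \<and> e = f then mono [] (rng G e) [] else 0)"
      using t_s[OF assms(2,3)] by (auto simp: mono_Nil)
    finally have eq: "t e * mono \<alpha> A \<beta> * s f \<approx> (if src G e \<in> A \<and> e = f then mono [] (rng G e) [] else 0)" .
    show ?thesis
      by (rule mspan_eqv[OF _ eqv_sym[OF eq]]) (use assms in \<open>auto intro!: mspan_zero mspan_mono1\<close>)
  next
    case (Cons g \<gamma>)
    then obtain h \<delta> where \<beta>: "\<beta> = h # \<delta>" using * by (cases \<beta>) auto
    have "t e * mono \<alpha> A \<beta> * s f = (t e * s g) * mono \<gamma> A \<delta> * (t h * s f)"
      by (simp add: Cons \<beta> mono_Cons_left mono_Cons_right mult.assoc)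
    also have "\<dots> \<approx> (if e = g then p (rng G e) else 0) * mono \<gamma> A \<delta> * (if h = f then p (rng G h) else 0)"
      using * Cons \<beta> assms by (intro eqv_mult eqv_refl t_s) auto
    finally have eq: "t e * mono \<alpha> A \<beta> * s f \<approx>
      (if e = g then p (rng G e) else 0) * mono \<gamma> A \<delta> * (if h = f then p (rng G h) else 0)" .
    show ?thesis
      by (rule mspan_eqv[OF _ eqv_sym[OF eq]])
        (use assms * Cons \<beta> in \<open>auto intro!: mspan_zero mspan_mono1 mspan_p_left mspan_p_right\<close>)
  qed
qed (simp_all add: distrib_left distrib_right scal_left_comm mult.assoc
      two_sided_left[OF two_sided_K] two_sided_right[OF two_sided_K])

section \<open>Combinations of the projections \<open>p A\<close>\<close>

lemma diag_zero_cases: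
  assumes "diag 0 (length \<alpha>) (length \<beta>)"
  shows "mono \<alpha> A \<beta> = p A"
  using assms by (auto simp: mono_Nil)

lemma p_disjoint:
  assumes "A \<in> gen_verts G" "B \<in> gen_verts G" "A \<inter> B = {}"
  shows "p (A \<union> B) \<approx> p A + p B"
proof -
  have "p (A \<union> B) \<approx> p A + p B - p {}"
    using p_union[OF assms(1,2)] assms(3) by simp
  also have "\<dots> \<approx> p A + p B - 0"
    by (intro eqv_diff eqv_refl p_empty)
  finally show ?thesis by simp
qed

lemma p_subset:
  assumes "A \<in> gen_verts G" "B \<in> gen_verts G" "A \<subseteq> B"
  shows "p A * p B \<approx> p A" "p B * p A \<approx> p A"
  using p_inter[OF assms(1,2)] p_inter[OF assms(2,1)] assms(3)
  by (simp_all add: Int_absorb1 Int_absorb2)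

text \<open>For a single \<open>p A\<close> both products reduce to the same sum, over the edges of
  \<open>F\<close> with source in \<open>A\<close>.\<close>

lemma diag_zero_edge_proj:
  assumes "a \<in> mspan (diag 0)" "F \<subseteq> edges G"
  shows "a * edge_proj F \<approx> edge_proj F * a"
  using assms(1)
proof (induction rule: mspan.induct)
  case (kernel x)
  then show ?case
    using two_sided_diff[OF two_sided_K two_sided_right[OF two_sided_K kernel] two_sided_left[OF two_sided_K kernel]]
    by (simp add: eqv_def)
next
  case (mono A \<alpha> \<beta> c)
  have "p A * edge_proj F \<approx> edge_proj F * p A"
    using p_edge_proj[OF mono(1) assms(2)] edge_proj_p[OF mono(1) assms(2)] by (blast intro: eqv_trans eqv_sym)
  then show ?case
    unfolding diag_zero_cases[OF mono(4)] by (simp add: scal_left_comm mult.assoc eqv_left)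
next
  case (add x y)
  then show ?case by (auto simp: distrib_left distrib_right intro: eqv_add)
qed

text \<open>The union of all sets occurring in \<open>a\<close> gives a local unit; it supplies the
  set from which the later cutting down of \<open>a\<close> starts.\<close>

lemma diag_zero_support:
  assumes "a \<in> mspan (diag 0)"
  shows "\<exists>D\<in>gen_verts G. p D * a \<approx> a"
  using assms
proof (induction rule: mspan.induct)
  case (kernel x)
  \<comment> \<open>The empty set will do, since \<open>x\<close> and all its multiples lie in
    \<open>K\<close>.\<close>
  then have "p {} * x \<approx> x"
    using two_sided_diff[OF two_sided_K two_sided_left[OF two_sided_K kernel] kernel] by (simp add: eqv_def)
  then show ?case by (intro bexI[of _ "{}"]) auto
next
  case (mono A \<alpha> \<beta> c)
  have "p A * (scal c * p A) \<approx> scal c * p A"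
    using p_subset(1)[OF mono(1) mono(1)] by (simp add: scal_left_comm eqv_left)
  then show ?case unfolding diag_zero_cases[OF mono(4)] using mono(1) by blast
next
  case (add x y)
  then obtain A B where AB: "A \<in> gen_verts G" "p A * x \<approx> x" "B \<in> gen_verts G" "p B * y \<approx> y"
    by blast
  have *: "p (A \<union> B) * z \<approx> z" if "p C * z \<approx> z" "C \<in> gen_verts G" "C \<subseteq> A \<union> B" for C z
  proof -
    have "p (A \<union> B) * z \<approx> p (A \<union> B) * (p C * z)" by (intro eqv_left eqv_sym[OF that(1)])
    also have "\<dots> = (p (A \<union> B) * p C) * z" by (simp add: mult.assoc)
    also have "\<dots> \<approx> p C * z" using that AB by (intro eqv_right p_subset) auto
    finally show ?thesis using that(1) eqv_trans by blast
  qed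
  have "p (A \<union> B) * (x + y) \<approx> x + y"
    using *[OF AB(2,1)] *[OF AB(4,3)] by (simp add: distrib_left eqv_add)
  then show ?case using AB by (intro bexI[of _ "A \<union> B"]) auto
qed

lemma finite_verts_gen: "finite V \<Longrightarrow> V \<subseteq> verts G \<Longrightarrow> V \<in> gen_verts G"
proof (induction V rule: finite_induct)
  case (insert v V)
  then have "{v} \<union> V \<in> gen_verts G" by (intro gen_verts.union gen_verts.single) auto
  then show ?case by simp
qed (rule gen_verts.empty)

lemma edge_proj_diff: "finite S \<Longrightarrow> T \<subseteq> S \<Longrightarrow> edge_proj (S - T) = edge_proj S - edge_proj T"
  by (simp add: edge_proj_def sum_diff)

section \<open>From the ideal \<open>I\<close> to the ideal \<open>J\<close>\<close>

definition gap :: "'v set \<Rightarrow> 'e set \<Rightarrow> 'a" where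
  "gap A S = p A - edge_proj S"

text \<open>In the application \<open>I\<close> is the lift of a graded ideal and \<open>J\<close>
  the lift of the ideal generated by its canonical generators. The results here concern homogeneous
  elements of \<open>I\<close>; gradedness enters when a general element is decomposed.\<close>

context
  fixes I J :: "'a set"
  assumes I: "two_sided I" "K \<subseteq> I" and J: "two_sided J" "K \<subseteq> J"
    and p_J: "\<And>A. A \<in> gen_verts G \<Longrightarrow> p A \<in> I \<Longrightarrow> p A \<in> J"
    and gap_J: "\<And>v H. H = {A \<in> gen_verts G. p A \<in> I} \<Longrightarrow> v \<in> breaking G H \<Longrightarrow>
      gap {v} {e \<in> out_edges G v. rng G e \<notin> H} \<in> I \<Longrightarrow>
      gap {v} {e \<in> out_edges G v. rng G e \<notin> H} \<in> J"
begin

lemma mem_I_cong: "x \<approx> y \<Longrightarrow> x \<in> I \<longleftrightarrow> y \<in> I"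
  and mem_J_cong: "x \<approx> y \<Longrightarrow> x \<in> J \<longleftrightarrow> y \<in> J"
  using eqv_mem I J by blast+

text \<open>The factor \<open>p (rng G e)\<close> can be inserted between \<open>s e\<close> and
  \<open>t e\<close>.\<close>

lemma s_t_mem:
  assumes "e \<in> edges G" "two_sided M" "K \<subseteq> M" "p (rng G e) \<in> M"
  shows "s e * t e \<in> M"
proof -
  have "s e * p (rng G e) * t e \<approx> s e * t e"
    by (intro eqv_right edge_rng assms)
  then show ?thesis
    using eqv_mem[OF assms(2,3)] two_sided_left[OF assms(2)] two_sided_right[OF assms(2)] assms(4) by blast
qed

lemma edge_proj_mem:
  assumes "S \<subseteq> edges G" "two_sided M" "K \<subseteq> M" "\<And>e. e \<in> S \<Longrightarrow> p (rng G e) \<in> M"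
  shows "edge_proj S \<in> M"
  unfolding edge_proj_def using assms by (intro two_sided_sum s_t_mem) auto

text \<open>The set \<open>F\<close> is exchanged for the canonical set \<open>T\<close> of edges
  from \<open>v\<close> whose range is outside \<open>H\<close>. The two gaps differ by an element
  of both ideals, so it suffices to place \<open>gap {v} T\<close> in \<open>J\<close>.\<close>

lemma vertex_gap_mem:
  assumes v: "v \<in> verts G" and F: "finite F" "F \<subseteq> out_edges G v" and "gap {v} F \<in> I"
  shows "gap {v} F \<in> J"
proof -
  have out: "out_edges G v \<subseteq> edges G" and src: "\<And>e. e \<in> out_edges G v \<Longrightarrow> src G e = v"
    by (auto simp: out_edges_def)
  define H where "H = {A \<in> gen_verts G. p A \<in> I}"
  define T where "T = {e \<in> out_edges G v. rng G e \<notin> H}"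
  \<comment> \<open>For an edge \<open>e\<close> from \<open>v\<close> outside \<open>F\<close>,
    multiplying the gap by \<open>t e\<close> and \<open>s e\<close> kills the sum over
    \<open>F\<close> and turns \<open>p {v}\<close> into \<open>p (rng G e)\<close>.\<close>
  have rng_I: "p (rng G e) \<in> I" if "e \<in> out_edges G v" "e \<notin> F" for e
  proof -
    have e: "e \<in> edges G" using that out by blast
    have "t e * gap {v} F * s e = (t e * p {v}) * s e - t e * (edge_proj F * s e)"
      by (simp add: gap_def algebra_simps)
    also have "\<dots> \<approx> t e * s e - t e * 0"
      using ghost_src[OF e] edge_proj_s[OF F(1) _ e] F out that src[OF that(1)]
      by (intro eqv_diff eqv_right eqv_left) auto
    also have "\<dots> = t e * s e" by simp
    also have "\<dots> \<approx> p (rng G e)" using ghost_edge[OF e e] by simp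
    finally show ?thesis
      using mem_I_cong two_sided_left[OF I(1)] two_sided_right[OF I(1)] assms(4) by blast
  qed
  have rng_H: "p (rng G e) \<in> I" "p (rng G e) \<in> J" if "e \<in> out_edges G v" "e \<notin> T" for e
    using that out p_J[of "rng G e"] by (auto simp: T_def H_def)
  have T: "T \<subseteq> F" "T \<subseteq> out_edges G v"
    using rng_I out by (auto simp: T_def H_def)
  then have "finite T" using F finite_subset by blast
  have gap_T: "gap {v} T = gap {v} F + edge_proj (F - T)"
    using edge_proj_diff[OF F(1) T(1)] by (simp add: gap_def)
  have "edge_proj (F - T) \<in> I" "edge_proj (F - T) \<in> J"
    using F out rng_H by (intro edge_proj_mem I J; blast)+
  have "gap {v} T \<in> I"
    unfolding gap_T by (intro two_sided_add I assms \<open>edge_proj (F - T) \<in> I\<close>)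
  have "gap {v} T \<in> J"
  proof (cases "T = {}")
    case True
    then show ?thesis
      using \<open>gap {v} T \<in> I\<close> p_J[of "{v}"] v by (auto simp: gap_def edge_proj_def)
  next
    case T_ne: False
    show ?thesis
    proof (cases "finite (out_edges G v)")
      case True
      \<comment> \<open>A nonempty \<open>T\<close> shows that \<open>v\<close> emits an edge. The
        regular-vertex relation then leaves a sum over edges outside \<open>T\<close>, whose range
        projections lie in \<open>J\<close>.\<close>
      then have "regular_vertex G v" using T T_ne v by (auto simp: regular_vertex_def)
      then have "p {v} \<approx> edge_proj (out_edges G v)"
        using regular by (simp add: edge_proj_def)
      then have "gap {v} T \<approx> edge_proj (out_edges G v - T)"
        unfolding gap_def edge_proj_diff[OF True T(2)] by (intro eqv_diff) auto
      moreover have "edge_proj (out_edges G v - T) \<in> J"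
        using out rng_H by (intro edge_proj_mem J; blast)
      ultimately show ?thesis using mem_J_cong by blast
    next
      case False
      then have "v \<in> breaking G H"
        using v T_ne \<open>finite T\<close> by (auto simp: breaking_def T_def)
      then show ?thesis
        using gap_J[OF H_def] \<open>gap {v} T \<in> I\<close> by (simp add: T_def)
    qed
  qed
  then have "gap {v} T - edge_proj (F - T) \<in> J"
    by (intro two_sided_diff J \<open>edge_proj (F - T) \<in> J\<close>)
  then show ?thesis by (simp add: gap_T)
qed

section \<open>Elements cut down by \<open>1 - edge_proj F\<close>\<close>

context
  fixes F :: "'e set"
  assumes F: "finite F" "F \<subseteq> edges G"
begin

abbreviation coproj :: 'a where "coproj \<equiv> 1 - edge_proj F"

lemma sub_coproj_mem_I:
  assumes "A \<in> gen_verts G" "B \<in> gen_verts G" "A \<subseteq> B" "p B * z \<in> I"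
  shows "p A * z \<in> I"
proof -
  have "p A * (p B * z) \<in> I" by (intro two_sided_left I assms)
  moreover have "p A * (p B * z) \<approx> p A * z"
    using p_subset(1)[OF assms(1-3)] by (simp add: eqv_right flip: mult.assoc)
  ultimately show ?thesis using mem_I_cong by blast
qed

lemma split_mem_J:
  assumes "A \<in> gen_verts G" "B \<in> gen_verts G" "p (A \<inter> B) * z \<in> J" "p (A - B) * z \<in> J"
  shows "p A * z \<in> J"
proof -
  have "p A \<approx> p (A \<inter> B) + p (A - B)"
    using p_disjoint[of "A \<inter> B" "A - B"] assms by (auto simp: Int_Diff_Un)
  then have "p A * z \<approx> (p (A \<inter> B) + p (A - B)) * z" by (intro eqv_right)
  then have "p A * z \<approx> p (A \<inter> B) * z + p (A - B) * z" by (simp add: distrib_right)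
  then show ?thesis using mem_J_cong two_sided_add[OF J(1)] assms by blast
qed

text \<open>Only the edges of \<open>F\<close> starting at \<open>v\<close> survive next to
  \<open>p {v}\<close>, so the product is a gap at \<open>v\<close>.\<close>

lemma vertex_coproj_mem:
  assumes v: "v \<in> verts G" and "p {v} * coproj \<in> I"
  shows "p {v} * coproj \<in> J"
proof -
  have "p {v} * edge_proj F \<approx> (\<Sum>e\<in>F. if src G e \<in> {v} then s e * t e else 0)"
    by (intro p_edge_proj F gen_verts.single v)
  also have "\<dots> = edge_proj (F \<inter> out_edges G v)"
    unfolding edge_proj_def using F by (subst sum.inter_restrict) (auto simp: out_edges_def intro!: sum.cong)
  finally have "p {v} * coproj \<approx> gap {v} (F \<inter> out_edges G v)"
    by (simp add: gap_def right_diff_distrib eqv_diff)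
  then show ?thesis
    using mem_I_cong mem_J_cong vertex_gap_mem[OF v, of "F \<inter> out_edges G v"] F assms(2) by blast
qed

lemma finite_verts_coproj_mem:
  assumes "finite V" "V \<subseteq> verts G" "\<And>v. v \<in> V \<Longrightarrow> p {v} * coproj \<in> I"
  shows "p V * coproj \<in> J"
  using assms
proof (induction V rule: finite_induct)
  case empty
  then show ?case
    using p_empty J by (auto simp: eqv_zero_iff intro: two_sided_right)
next
  case (insert v V)
  have "insert v V \<in> gen_verts G" using insert by (intro finite_verts_gen) auto
  moreover have "{v} \<in> gen_verts G" using insert by auto
  moreover have "p {v} * coproj \<in> J" "p V * coproj \<in> J"
    using insert by (auto intro!: vertex_coproj_mem)
  ultimately show ?case
    using split_mem_J[of "insert v V" "{v}" coproj] insert by auto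
qed

text \<open>\<open>D\<close> is split along the finite set \<open>V\<close> of sources of edges in
  \<open>F\<close>. On \<open>D \<inter> V\<close> the claim is checked vertex by vertex; on
  \<open>D - V\<close> the factor \<open>coproj\<close> acts as \<open>1\<close>, so that
  \<open>p (D - V)\<close> itself lies in \<open>I\<close>, hence in \<open>J\<close>.\<close>

lemma p_coproj_mem:
  assumes D: "D \<in> gen_verts G" and mem: "p D * coproj \<in> I"
  shows "p D * coproj \<in> J"
proof -
  define V where "V = src G ` F"
  have V: "finite V" "V \<subseteq> verts G" using F src_in_verts by (auto simp: V_def)
  then have V_gen: "V \<in> gen_verts G" by (rule finite_verts_gen)
  have "p {v} * coproj \<in> I" if "v \<in> D \<inter> V" for v
    using that V by (intro sub_coproj_mem_I[OF _ D _ mem]) auto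
  then have 1: "p (D \<inter> V) * coproj \<in> J"
    using V by (intro finite_verts_coproj_mem) auto
  have DV: "D - V \<in> gen_verts G" using D V_gen by auto
  have "p (D - V) * edge_proj F \<approx> (\<Sum>e\<in>F. if src G e \<in> D - V then s e * t e else 0)"
    by (intro p_edge_proj F DV)
  also have "\<dots> = 0" by (intro sum.neutral) (auto simp: V_def)
  finally have "p (D - V) * coproj \<approx> p (D - V) - 0"
    unfolding right_diff_distrib by (intro eqv_diff) auto
  then have eq: "p (D - V) * coproj \<approx> p (D - V)" by simp
  have "p (D - V) * coproj \<in> I"
    by (rule sub_coproj_mem_I[OF DV D _ mem]) auto
  then have "p (D - V) * coproj \<in> J"
    using eq mem_I_cong mem_J_cong p_J[OF DV] by blast
  then show ?thesis using split_mem_J[OF D V_gen] 1 by blast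
qed

text \<open>
  The summands of \<open>a\<close> are absorbed one at a time: on a set on which the newest \<open>p\<^sub>A\<close> is constant it
  can be replaced by a scalar.
\<close>

lemma diag_zero_absorb:
  assumes "a \<in> mspan (diag 0)"
    and "\<And>c D. D \<in> gen_verts G \<Longrightarrow> p D * ((b + scal c) * coproj) \<in> I \<Longrightarrow> p D * ((b + scal c) * coproj) \<in> J"
    and "D \<in> gen_verts G" "p D * ((b + a + scal c) * coproj) \<in> I"
  shows "p D * ((b + a + scal c) * coproj) \<in> J"
  using assms
proof (induction arbitrary: b c D rule: mspan.induct)
  case (kernel x)
  have "b + x + scal c \<approx> b + scal c"
    using kernel by (simp add: eqv_def algebra_simps)
  then have "p D * ((b + x + scal c) * coproj) \<approx> p D * ((b + scal c) * coproj)"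
    by (intro eqv_left eqv_right)
  then show ?case using kernel mem_I_cong mem_J_cong by blast
next
  case (mono A \<alpha> \<beta> d)
  define z where "z = b + scal d * local.mono \<alpha> A \<beta> + scal c"
  have z: "z = b + scal d * p A + scal c"
    unfolding z_def diag_zero_cases[OF mono(4)] ..
  have D: "D \<in> gen_verts G" and mem: "p D * (z * coproj) \<in> I"
    using mono.prems by (auto simp: z_def)
  \<comment> \<open>If the summand acts on \<open>B\<close> as a scalar, that scalar joins
    \<open>c\<close>, and the hypothesis about \<open>b\<close> applies on \<open>B\<close>.\<close>
  have step: "p B * (z * coproj) \<in> J"
    if "B \<in> gen_verts G" "B \<subseteq> D" "p B * z \<approx> p B * (b + scal c')" for B c'
  proof -
    have "p B * (z * coproj) \<approx> p B * ((b + scal c') * coproj)"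
      using eqv_right[OF that(3)] by (simp add: mult.assoc)
    moreover have "p B * (z * coproj) \<in> I"
      using sub_coproj_mem_I[OF that(1) D that(2) mem] .
    ultimately show ?thesis
      using mono.prems(1)[OF that(1)] mem_I_cong mem_J_cong by blast
  qed
  have expand: "p B * z = p B * (b + scal c) + scal d * (p B * p A)" for B
    by (simp add: z distrib_left scal_left_comm algebra_simps)
  \<comment> \<open>On \<open>D \<inter> A\<close> the projection \<open>p A\<close> acts as
    \<open>1\<close>, so the scalar becomes \<open>c + d\<close>.\<close>
  have "p (D \<inter> A) * z \<approx> p (D \<inter> A) * (b + scal c) + scal d * p (D \<inter> A)"
    unfolding expand using p_subset(1)[of "D \<inter> A" A] D mono(1) by (intro eqv_add eqv_left) auto
  also have "\<dots> = p (D \<inter> A) * (b + scal (c + d))"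
    using scal_comm[of "p (D \<inter> A)" d] by (simp add: scal_add algebra_simps)
  finally have 1: "p (D \<inter> A) * (z * coproj) \<in> J"
    using D mono(1) by (intro step) auto
  \<comment> \<open>On \<open>D - A\<close> it acts as \<open>0\<close>, and the scalar remains
    \<open>c\<close>.\<close>
  have "p (D - A) * p A \<approx> p ((D - A) \<inter> A)"
    using D mono(1) by (intro p_inter) auto
  also have "(D - A) \<inter> A = {}" by blast
  finally have "p (D - A) * p A \<approx> 0"
    using p_empty eqv_trans by blast
  then have "p (D - A) * z \<approx> p (D - A) * (b + scal c) + scal d * 0"
    unfolding expand by (intro eqv_add eqv_left) auto
  then have 2: "p (D - A) * (z * coproj) \<in> J"
    using D mono(1) by (intro step) auto
  show ?case using split_mem_J[OF D mono(1) 1 2] by (simp add: z_def)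
next
  case (add x y)
  have "p D * ((b + x + y + scal c) * coproj) \<in> J"
  \<comment> \<open>First \<open>y\<close> is absorbed, with \<open>b + x\<close> in the role of
    \<open>b\<close>; the hypothesis this needs is the one obtained by absorbing
    \<open>x\<close>.\<close>
  proof (rule add.IH(2))
    show "p D * ((b + x + scal c) * coproj) \<in> J"
      if "D \<in> gen_verts G" "p D * ((b + x + scal c) * coproj) \<in> I" for c D
      using add.IH(1)[OF add.prems(1) that] .
  qed (use add.prems in \<open>simp_all add: add.assoc\<close>)
  then show ?case by (simp add: add.assoc)
qed

lemma diag_zero_coproj_mem:
  assumes a: "a \<in> mspan (diag 0)" and mem: "a * coproj \<in> I"
  shows "a * coproj \<in> J"
proof -
  obtain D where D: "D \<in> gen_verts G" "p D * a \<approx> a"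
    using diag_zero_support[OF a] by blast
  have eq: "p D * (a * coproj) \<approx> a * coproj"
    using eqv_right[OF D(2)] by (simp add: mult.assoc)
  have "p B * ((0 + scal c) * coproj) \<in> J"
    if B: "B \<in> gen_verts G" "p B * ((0 + scal c) * coproj) \<in> I" for c B
  \<comment> \<open>Once everything is absorbed only a scalar multiple of
    \<open>p B * coproj\<close> is left. A nonzero scalar is invertible, which leads back to
    \<open>p_coproj_mem\<close>.\<close>
  proof (cases "c = 0")
    case True
    then show ?thesis using two_sided_zero[OF J(1)] by (simp add: scal_0)
  next
    case False
    have eq: "p B * ((0 + scal c) * coproj) = scal c * (p B * coproj)"
      using scal_left_comm by simp
    have "scal (inverse c) * (scal c * (p B * coproj)) = p B * coproj"
      using False by (simp add: scal_1 flip: mult.assoc scal_mult)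
    then have "p B * coproj \<in> I"
      using two_sided_left[OF I(1) B(2), of "scal (inverse c)"] by (simp only: eq)
    then show ?thesis
      unfolding eq by (rule two_sided_left[OF J(1) p_coproj_mem[OF B(1)]])
  qed
  \<comment> \<open>Absorption starts with \<open>b\<close> and the scalar both zero; multiplying by
    \<open>p D\<close> does not change \<open>a * coproj\<close>.\<close>
  moreover have "p D * ((0 + a + scal 0) * coproj) \<in> I"
    using mem_I_cong[OF eq] mem by (simp add: scal_0)
  ultimately have "p D * ((0 + a + scal 0) * coproj) \<in> J"
    using diag_zero_absorb[OF a _ D(1)] by blast
  then show ?thesis using mem_J_cong[OF eq] by (simp add: scal_0)
qed

end

section \<open>Homogeneous elements, first of degree zero\<close>

lemma diag_mem:
  assumes "x \<in> mspan (diag N)" "x \<in> I"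
  shows "x \<in> J"
  using assms
proof (induction N arbitrary: x)
  case 0
  \<comment> \<open>For \<open>F = {}\<close> the factor \<open>coproj\<close> is
    \<open>1\<close>.\<close>
  then show ?case using diag_zero_coproj_mem[of "{}" x] by (simp add: edge_proj_def)
next
  case (Suc N)
  \<comment> \<open>The monomials of length zero are separated off. Those in \<open>y\<close> have
    edges on both sides, so a large \<open>F\<close> fixes \<open>y\<close> from the left and from
    the right.\<close>
  obtain a y where a: "a \<in> mspan (\<lambda>i j. diag (Suc N) i j \<and> i = 0)"
    and y: "y \<in> mspan (\<lambda>i j. diag (Suc N) i j \<and> i \<noteq> 0)" and x: "x = a + y"
    using mspan_split[OF Suc.prems(1), of "\<lambda>i j. i = 0"] by blast
  have a0: "a \<in> mspan (diag 0)" by (rule mspan_weaken[OF a]) auto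
  have left: "\<forall>\<^sub>F F in finite_subsets_at_top (edges G). edge_proj F * y \<approx> y"
    by (rule edge_proj_fixes_left[OF y]) auto
  have right: "\<forall>\<^sub>F F in finite_subsets_at_top (edges G). y * edge_proj F \<approx> y"
    by (rule edge_proj_fixes_right[OF y]) auto
  obtain F where F: "finite F" "F \<subseteq> edges G" and "edge_proj F * y \<approx> y \<and> y * edge_proj F \<approx> y"
    using eventually_conj[OF left right] by (rule eventually_finite_edges_ex)
  then have y_F: "edge_proj F * y \<approx> y" "y * edge_proj F \<approx> y" by auto
  let ?E = "edge_proj F"
  \<comment> \<open>Each inner factor \<open>t e * x * s f\<close> lies in \<open>I\<close> and
    satisfies the bound \<open>N\<close>, so the induction hypothesis covers it.\<close>
  have "?E * x * ?E = (\<Sum>e\<in>F. \<Sum>f\<in>F. s e * (t e * x * s f) * t f)"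
    unfolding edge_proj_def sum_distrib_right[of _ F x] sum_product by (simp add: mult.assoc)
  also have "\<dots> \<in> J"
  proof (intro two_sided_sum[OF J(1)])
    fix e f assume "e \<in> F" "f \<in> F"
    then have "t e * x * s f \<in> mspan (diag N)"
      using F by (intro mspan_t_s Suc.prems) auto
    moreover have "t e * x * s f \<in> I"
      by (intro two_sided_left two_sided_right I Suc.prems)
    ultimately have "t e * x * s f \<in> J" by (rule Suc.IH)
    then show "s e * (t e * x * s f) * t f \<in> J"
      by (rule two_sided_right[OF J(1) two_sided_left[OF J(1)]])
  qed
  finally have ExE: "?E * x * ?E \<in> J" .
  have "?E * y * ?E \<approx> y"
    using eqv_trans[OF eqv_right[OF y_F(1)] y_F(2)] .
  moreover have "?E * a * ?E \<approx> a * ?E"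
  proof -
    have "?E * a * ?E \<approx> a * ?E * ?E"
      by (intro eqv_right eqv_sym[OF diag_zero_edge_proj] a0 F)
    also have "\<dots> = a * (?E * ?E)" by (simp add: mult.assoc)
    also have "\<dots> \<approx> a * ?E" by (intro eqv_left edge_proj_idem F)
    finally show ?thesis .
  qed
  \<comment> \<open>The contributions of \<open>y\<close> cancel; since \<open>a\<close> commutes
    with the idempotent \<open>?E\<close>, only \<open>a * (1 - ?E)\<close> remains.\<close>
  ultimately have "x - (?E * a * ?E + ?E * y * ?E) \<approx> x - (a * ?E + y)"
    by (intro eqv_diff eqv_add) auto
  then have eq: "x - ?E * x * ?E \<approx> a * (1 - ?E)"
    by (simp add: x algebra_simps)
  have "x - ?E * x * ?E \<in> I"
    by (intro two_sided_diff two_sided_left two_sided_right I Suc.prems)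
  then have "x - ?E * x * ?E \<in> J"
    using diag_zero_coproj_mem[OF F a0] mem_I_cong[OF eq] mem_J_cong[OF eq] by blast
  then show ?case using two_sided_add[OF J(1) _ ExE] by fastforce
qed

lemma degree_nonneg_mem:
  assumes "x \<in> mspan (degree (int n))" "x \<in> I"
  shows "x \<in> J"
  using assms
proof (induction n arbitrary: x)
  case 0
  then show ?case using mspan_degree_zero[of x] diag_mem by auto
next
  case (Suc n)
  have "\<forall>\<^sub>F F in finite_subsets_at_top (edges G). edge_proj F * x \<approx> x"
    \<comment> \<open>Positive degree forces \<open>\<alpha>\<close> to be nonempty in every
      monomial.\<close>
    by (rule edge_proj_fixes_left[OF Suc.prems(1)]) simp
  then obtain F where F: "F \<subseteq> edges G" "edge_proj F * x \<approx> x"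
    by (rule eventually_finite_edges_ex)
  have "edge_proj F * x = (\<Sum>e\<in>F. s e * (t e * x))"
    by (simp add: edge_proj_def sum_distrib_right mult.assoc)
  also have "\<dots> \<in> J"
  proof (intro two_sided_sum[OF J(1)])
    fix e assume "e \<in> F"
    then have "t e * x \<in> mspan (degree (int n))"
      using mspan_t_left[OF Suc.prems(1), of e] F by auto
    then have "t e * x \<in> J"
      using Suc.IH two_sided_left[OF I(1) Suc.prems(2)] by blast
    then show "s e * (t e * x) \<in> J" by (rule two_sided_left[OF J(1)])
  qed
  finally show ?case using mem_J_cong[OF F(2)] by blast
qed

lemma degree_nonpos_mem:
  assumes "x \<in> mspan (degree (- int n))" "x \<in> I"
  shows "x \<in> J"
  using assms
proof (induction n arbitrary: x)
  case 0
  then show ?case using degree_nonneg_mem[of x 0] by simp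
next
  case (Suc n)
  have "\<forall>\<^sub>F F in finite_subsets_at_top (edges G). x * edge_proj F \<approx> x"
    by (rule edge_proj_fixes_right[OF Suc.prems(1)]) simp
  then obtain F where F: "F \<subseteq> edges G" "x * edge_proj F \<approx> x"
    by (rule eventually_finite_edges_ex)
  have "x * edge_proj F = (\<Sum>e\<in>F. x * s e * t e)"
    by (simp add: edge_proj_def sum_distrib_left mult.assoc)
  also have "\<dots> \<in> J"
  proof (intro two_sided_sum[OF J(1)])
    fix e assume "e \<in> F"
    then have "x * s e \<in> mspan (degree (- int n))"
      using mspan_s_right[OF Suc.prems(1), of e] F by auto
    then have "x * s e \<in> J"
      using Suc.IH two_sided_right[OF I(1) Suc.prems(2)] by blast
    then show "x * s e * t e \<in> J" by (rule two_sided_right[OF J(1)])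
  qed
  finally show ?case using mem_J_cong[OF F(2)] by blast
qed

lemma homogeneous_mem:
  assumes "x \<in> mspan (degree n)" "x \<in> I"
  shows "x \<in> J"
  using assms degree_nonneg_mem[of x "nat n"] degree_nonpos_mem[of x "nat (- n)"]
  by (cases "n \<ge> 0") auto

end

end


section \<open>Nonunital algebras as records\<close>

text \<open>Both the free algebra and its quotient are instances. Negation as scaling by
  \<open>- 1\<close> turns a subset closed under sums and scalars into an additive subgroup.\<close>

locale record_alg = abelian_group L for L :: "('k::field, 'a, 'm) module_scheme" (structure) +
  assumes neg_smult: "x \<in> carrier L \<Longrightarrow> \<ominus> x = (- 1) \<odot>\<^bsub>L\<^esub> x"
    and smult_carrier: "x \<in> carrier L \<Longrightarrow> c \<odot>\<^bsub>L\<^esub> x \<in> carrier L"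
    and mult_carrier: "x \<in> carrier L \<Longrightarrow> y \<in> carrier L \<Longrightarrow> x \<otimes> y \<in> carrier L"
begin

lemma lin_subspaceI:
  assumes "W \<subseteq> carrier L" "\<zero> \<in> W" "\<And>x y. x \<in> W \<Longrightarrow> y \<in> W \<Longrightarrow> x \<oplus> y \<in> W"
    and "\<And>c x. x \<in> W \<Longrightarrow> c \<odot>\<^bsub>L\<^esub> x \<in> W"
  shows "lin_subspace L W"
  unfolding lin_subspace_def additive_subgroup_def
proof (intro conjI allI ballI subgroup.intro)
  show "inv\<^bsub>add_monoid L\<^esub> x \<in> W" if "x \<in> W" for x
    using neg_smult[of x] assms that by (auto simp: a_inv_def)
qed (use assms in auto)

lemma lin_subspaceD:
  assumes "lin_subspace L W"
  shows "W \<subseteq> carrier L" "\<zero> \<in> W" "\<And>x y. x \<in> W \<Longrightarrow> y \<in> W \<Longrightarrow> x \<oplus> y \<in> W"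
    and "\<And>c x. x \<in> W \<Longrightarrow> c \<odot>\<^bsub>L\<^esub> x \<in> W"
  using assms unfolding lin_subspace_def
  by (auto dest: additive_subgroup.a_subset additive_subgroup.zero_closed additive_subgroup.a_closed)

lemma alg_idealI:
  assumes "W \<subseteq> carrier L" "\<zero> \<in> W" "\<And>x y. x \<in> W \<Longrightarrow> y \<in> W \<Longrightarrow> x \<oplus> y \<in> W"
    and "\<And>c x. x \<in> W \<Longrightarrow> c \<odot>\<^bsub>L\<^esub> x \<in> W"
    and "\<And>x a. x \<in> carrier L \<Longrightarrow> a \<in> W \<Longrightarrow> x \<otimes> a \<in> W"
    and "\<And>x a. x \<in> carrier L \<Longrightarrow> a \<in> W \<Longrightarrow> a \<otimes> x \<in> W"
  shows "alg_ideal L W"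
  using assms by (auto simp: alg_ideal_def intro: lin_subspaceI)

lemma alg_idealD:
  assumes "alg_ideal L W"
  shows "W \<subseteq> carrier L" "\<zero> \<in> W" "\<And>x y. x \<in> W \<Longrightarrow> y \<in> W \<Longrightarrow> x \<oplus> y \<in> W"
    and "\<And>c x. x \<in> W \<Longrightarrow> c \<odot>\<^bsub>L\<^esub> x \<in> W"
    and "\<And>x a. x \<in> carrier L \<Longrightarrow> a \<in> W \<Longrightarrow> x \<otimes> a \<in> W"
    and "\<And>x a. x \<in> carrier L \<Longrightarrow> a \<in> W \<Longrightarrow> a \<otimes> x \<in> W"
proof -
  have *: "lin_subspace L W" using assms by (simp add: alg_ideal_def)
  show "W \<subseteq> carrier L" "\<zero> \<in> W" "\<And>x y. x \<in> W \<Longrightarrow> y \<in> W \<Longrightarrow> x \<oplus> y \<in> W"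
    "\<And>c x. x \<in> W \<Longrightarrow> c \<odot>\<^bsub>L\<^esub> x \<in> W"
    using lin_subspaceD[OF *] by auto
qed (use assms in \<open>auto simp: alg_ideal_def\<close>)

lemma alg_ideal_gen:
  assumes "X \<subseteq> carrier L"
  shows "alg_ideal L (ideal_gen L X)"
proof (intro alg_idealI)
  \<comment> \<open>The carrier belongs to the family being intersected, which keeps the
    intersection inside it.\<close>
  have "alg_ideal L (carrier L)"
    by (intro alg_idealI) (auto intro: smult_carrier mult_carrier)
  then show "ideal_gen L X \<subseteq> carrier L"
    using assms by (auto simp: ideal_gen_def)
qed (auto simp: ideal_gen_def dest: alg_idealD)

lemma lin_subspace_span:
  assumes "X \<subseteq> carrier L"
  shows "lin_subspace L (lin_span L X)"
proof (intro lin_subspaceI)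
  have "lin_subspace L (carrier L)"
    by (intro lin_subspaceI) (auto intro: smult_carrier)
  then show "lin_span L X \<subseteq> carrier L"
    using assms by (auto simp: lin_span_def)
qed (auto simp: lin_span_def dest: lin_subspaceD)

end

lemma ideal_gen_superset: "X \<subseteq> ideal_gen L X"
  and ideal_gen_least: "alg_ideal L I \<Longrightarrow> X \<subseteq> I \<Longrightarrow> ideal_gen L X \<subseteq> I"
  and lin_span_superset: "X \<subseteq> lin_span L X"
  and lin_span_least: "lin_subspace L W \<Longrightarrow> X \<subseteq> W \<Longrightarrow> lin_span L X \<subseteq> W"
  by (auto simp: ideal_gen_def lin_span_def)


section \<open>Free algebras and their quotients\<close>

lemma poly_mapping_keys_induct [consumes 1, case_names zero single add]:
  assumes "Poly_Mapping.keys x \<subseteq> S" and "P 0"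
    and "\<And>w c. w \<in> S \<Longrightarrow> P (Poly_Mapping.single w c)"
    and "\<And>x y. P x \<Longrightarrow> P y \<Longrightarrow> P (x + y)"
  shows "P (x :: 'b \<Rightarrow>\<^sub>0 'c::monoid_add)"
  using assms(1)
proof (induction x rule: Poly_Mapping.update_induct)
  case (update f w c)
  \<comment> \<open>At a word outside the support, updating the coefficient amounts to adding a
    monomial.\<close>
  have "Poly_Mapping.update w c f = f + Poly_Mapping.single w c"
    using update(1)
    by (intro poly_mapping_eqI) (auto simp: lookup_update lookup_add lookup_single in_keys_iff when_def)
  moreover have "P f" "w \<in> S"
    using update by (simp_all add: keys_update)
  ultimately show ?case
    by (simp add: assms(3,4))
qed (rule assms)

text \<open>The neutral word \<open>0\<close> is the empty list, so these are the multiples of the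
  unit; they lie outside the nonunital free algebra unless \<open>c = 0\<close>.\<close>

abbreviation const :: "'k \<Rightarrow> 'g list \<Rightarrow>\<^sub>0 'k::field" where
  "const \<equiv> Poly_Mapping.single 0"

lemma const_left_single: "const c * Poly_Mapping.single w d = Poly_Mapping.single w (c * d)"
  and const_right_single: "Poly_Mapping.single w d * const c = Poly_Mapping.single w (c * d)"
  by (simp_all add: mult_single mult.commute)

lemma const_comm: "x * const c = const c * (x :: 'g list \<Rightarrow>\<^sub>0 'k::field)"
  by (rule poly_mapping_keys_induct[of x UNIV])
    (simp_all add: const_left_single const_right_single distrib_left distrib_right)

lemma lookup_map_mult: "Poly_Mapping.lookup (Poly_Mapping.map ((*) c) x) k = c * Poly_Mapping.lookup (x :: 'b \<Rightarrow>\<^sub>0 'k::field) k"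
  by (simp add: Poly_Mapping.map.rep_eq when_def)

text \<open>Turns scalar multiplication into ring multiplication, so that two-sided ideals of the
  unital ring are closed under scalars.\<close>

lemma map_eq_const_mult: "Poly_Mapping.map ((*) c) x = const c * (x :: 'g list \<Rightarrow>\<^sub>0 'k::field)"
proof (rule poly_mapping_keys_induct[of x UNIV])
  show "Poly_Mapping.map ((*) c) (x + y) = const c * (x + y)"
    if "Poly_Mapping.map ((*) c) x = const c * x" "Poly_Mapping.map ((*) c) y = const c * y"
    for x y :: "'g list \<Rightarrow>\<^sub>0 'k"
    unfolding distrib_left that[symmetric]
    by (intro poly_mapping_eqI) (simp add: lookup_map_mult lookup_add distrib_left)
  show "Poly_Mapping.map ((*) c) (Poly_Mapping.single w d) = const c * Poly_Mapping.single w d"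
    for w :: "'g list" and d
    unfolding const_left_single
    by (intro poly_mapping_eqI) (simp add: lookup_map_mult lookup_single when_def)
qed (auto intro!: poly_mapping_eqI simp: lookup_map_mult)

lemma free_alg_simps [simp]:
  "mult (free_alg X) = (*)" "zero (free_alg X) = 0" "add (free_alg X) = (+)"
  "smult (free_alg X) c x = const c * x"
  by (simp_all add: free_alg_def map_eq_const_mult)

lemma free_alg_carrier: "f \<in> carrier (free_alg X) \<longleftrightarrow> (\<forall>w\<in>Poly_Mapping.keys f. w \<noteq> [] \<and> set w \<subseteq> X)"
  by (simp add: free_alg_def)

lemma free_alg_single: "w \<noteq> [] \<Longrightarrow> set w \<subseteq> X \<Longrightarrow> Poly_Mapping.single w c \<in> carrier (free_alg X)"
  by (simp add: free_alg_carrier)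

lemma free_alg_zero: "0 \<in> carrier (free_alg X)"
  and free_alg_var: "x \<in> X \<Longrightarrow> var x \<in> carrier (free_alg X)"
  by (simp_all add: free_alg_carrier var_def)

lemma free_alg_add:
  "f \<in> carrier (free_alg X) \<Longrightarrow> g \<in> carrier (free_alg X) \<Longrightarrow> f + g \<in> carrier (free_alg X)"
  using Poly_Mapping.keys_add[of f g] by (auto simp: free_alg_carrier)

lemma free_alg_mult:
  "f \<in> carrier (free_alg X) \<Longrightarrow> g \<in> carrier (free_alg X) \<Longrightarrow> f * g \<in> carrier (free_alg X)"
  using Poly_Mapping.keys_mult[of f g] unfolding free_alg_carrier plus_list_def
  by (fastforce dest!: subsetD)

lemma free_alg_const:
  "f \<in> carrier (free_alg X) \<Longrightarrow> const c * f \<in> carrier (free_alg X)"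
  using Poly_Mapping.keys_mult[of "const c" f] unfolding free_alg_carrier plus_list_def zero_list_def
  by (fastforce dest!: subsetD split: if_splits)

lemma free_alg_uminus: "f \<in> carrier (free_alg X) \<Longrightarrow> - f \<in> carrier (free_alg X)"
  using free_alg_const[of f X "- 1"] by (simp add: single_uminus)

lemma free_alg_diff:
  "f \<in> carrier (free_alg X) \<Longrightarrow> g \<in> carrier (free_alg X) \<Longrightarrow> f - g \<in> carrier (free_alg X)"
  using free_alg_add[of f X "- g"] free_alg_uminus[of g X] by simp

lemma free_alg_sum:
  "(\<And>i. i \<in> A \<Longrightarrow> h i \<in> carrier (free_alg X)) \<Longrightarrow> sum h A \<in> carrier (free_alg X)"
  by (induction A rule: infinite_finite_induct) (auto intro: free_alg_zero free_alg_add)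

lemmas free_alg_closed =
  free_alg_zero free_alg_var free_alg_add free_alg_mult free_alg_const free_alg_uminus
  free_alg_diff free_alg_sum

lemma abelian_group_free_alg: "abelian_group (free_alg X)"
proof (rule abelian_groupI)
  show "\<exists>y\<in>carrier (free_alg X). y \<oplus>\<^bsub>free_alg X\<^esub> x = \<zero>\<^bsub>free_alg X\<^esub>"
    if "x \<in> carrier (free_alg X)" for x :: "'a list \<Rightarrow>\<^sub>0 'b"
    using that by (intro bexI[of _ "- x"]) (auto intro: free_alg_uminus)
qed (auto intro: free_alg_closed simp: add.assoc add.commute)

lemma record_alg_free_alg: "record_alg (free_alg X :: ('k::field, 'g list \<Rightarrow>\<^sub>0 'k) module)"
proof -
  interpret abelian_group "free_alg X :: ('k, 'g list \<Rightarrow>\<^sub>0 'k) module" by (rule abelian_group_free_alg)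
  show ?thesis
  proof
    fix x :: "'g list \<Rightarrow>\<^sub>0 'k" assume "x \<in> carrier (free_alg X)"
    then show "\<ominus>\<^bsub>free_alg X\<^esub> x = (- 1) \<odot>\<^bsub>free_alg X\<^esub> x"
      using minus_equality[of "- x" x] by (auto intro: free_alg_uminus simp: single_uminus)
  qed (auto intro: free_alg_closed)
qed

text \<open>
  An ideal of the quotient is lifted to a two-sided ideal of the
  unital free algebra on all symbols, in which words with a symbol outside \<open>X\<close> count as zero, so
  that no carrier conditions remain.
\<close>

locale free_quot =
  fixes X :: "'g set" and K :: "('g list \<Rightarrow>\<^sub>0 'k::field) set"
  assumes ideal_K: "alg_ideal (free_alg X) K"
begin

abbreviation F :: "('g list \<Rightarrow>\<^sub>0 'k) set" where "F \<equiv> carrier (free_alg X)"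

abbreviation Q :: "('k, ('g list \<Rightarrow>\<^sub>0 'k) set) module" where "Q \<equiv> alg_quot (free_alg X) K"

section \<open>The operations of the quotient on representatives\<close>

definition proj :: "('g list \<Rightarrow>\<^sub>0 'k) \<Rightarrow> ('g list \<Rightarrow>\<^sub>0 'k) set" where
  "proj f = K +>\<^bsub>(free_alg X :: ('k, 'g list \<Rightarrow>\<^sub>0 'k) module)\<^esub> f"

lemmas K_props = record_alg.alg_idealD[OF record_alg_free_alg ideal_K, unfolded free_alg_simps]

lemma K_uminus: "x \<in> K \<Longrightarrow> - x \<in> K"
  using K_props(4)[of x "- 1"] by (simp add: single_uminus)

lemma K_diff: "x \<in> K \<Longrightarrow> y \<in> K \<Longrightarrow> x - y \<in> K"
  using K_props(3)[of x "- y"] K_uminus[of y] by simp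

lemma mem_proj: "h \<in> proj f \<longleftrightarrow> h - f \<in> K"
  unfolding proj_def a_r_coset_def' by (auto intro: bexI[of _ "h - f"])

lemma proj_eq_iff: "proj f = proj g \<longleftrightarrow> f - g \<in> K"
proof
  assume "proj f = proj g"
  then show "f - g \<in> K" using mem_proj K_props(2) by (metis diff_self)
next
  assume *: "f - g \<in> K"
  have "h - f \<in> K \<longleftrightarrow> h - g \<in> K" for h
    using K_props(3)[OF _ *, of "h - f"] K_diff[OF _ *, of "h - g"] by (auto simp: algebra_simps)
  then show "proj f = proj g" by (auto simp: mem_proj)
qed

lemma carrier_Q: "carrier Q = proj ` F"
  by (auto simp: alg_quot_def A_RCOSETS_def' proj_def)

lemma zero_Q: "\<zero>\<^bsub>Q\<^esub> = proj 0"
  by (auto simp: alg_quot_def mem_proj)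

lemma add_Q: "proj f \<oplus>\<^bsub>Q\<^esub> proj g = proj (f + g)"
proof -
  have "proj f \<oplus>\<^bsub>Q\<^esub> proj g = {h + k | h k. h \<in> proj f \<and> k \<in> proj g}"
    by (auto simp: alg_quot_def set_add_def')
  also have "\<dots> = proj (f + g)"
  proof (intro equalityI subsetI)
    fix x assume "x \<in> proj (f + g)"
    then have "x - g \<in> proj f" "g \<in> proj g" "x = (x - g) + g"
      using K_props(2) by (auto simp: mem_proj algebra_simps)
    then show "x \<in> {h + k | h k. h \<in> proj f \<and> k \<in> proj g}" by blast
  next
    fix x assume "x \<in> {h + k | h k. h \<in> proj f \<and> k \<in> proj g}"
    then obtain h k where "x = h + k" "h - f \<in> K" "k - g \<in> K" by (auto simp: mem_proj)
    then show "x \<in> proj (f + g)"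
      using K_props(3)[of "h - f" "k - g"] by (simp add: mem_proj algebra_simps)
  qed
  finally show ?thesis .
qed

lemma proj_in_F: "h \<in> proj f \<Longrightarrow> f \<in> F \<Longrightarrow> h \<in> F"
  using free_alg_add[of "h - f" X f] K_props(1) by (auto simp: mem_proj)

text \<open>Representatives are taken in \<open>F\<close> because \<open>K\<close> absorbs products
  only with elements of \<open>F\<close>.\<close>

lemma mult_Q:
  assumes "f \<in> F" "g \<in> F"
  shows "proj f \<otimes>\<^bsub>Q\<^esub> proj g = proj (f * g)"
proof -
  have "proj (h * k) = proj (f * g)" if "h \<in> proj f" "k \<in> proj g" for h k
  proof -
    have "h * k - f * g = (h - f) * k + f * (k - g)" by (simp add: algebra_simps)
    also have "\<dots> \<in> K"
      using that assms proj_in_F by (intro K_props) (auto simp: mem_proj)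
    finally show ?thesis by (simp add: proj_eq_iff)
  qed
  then have "(\<Union>h\<in>proj f. \<Union>k\<in>proj g. proj (h * k)) = (\<Union>h\<in>proj f. \<Union>k\<in>proj g. proj (f * g))"
    by (intro SUP_cong refl)
  also have "\<dots> = proj (f * g)"
  proof -
    have "proj f \<noteq> {}" "proj g \<noteq> {}" using K_props(2) mem_proj by (metis diff_self empty_iff)+
    then show ?thesis by simp
  qed
  finally show ?thesis
    by (simp add: alg_quot_def rcoset_mult_def proj_def)
qed

lemma smult_Q: "c \<odot>\<^bsub>Q\<^esub> proj f = proj (const c * f)"
proof -
  have "proj (const c * h) = proj (const c * f)" if "h \<in> proj f" for h
    using that K_props(4)[of "h - f" c] by (simp add: proj_eq_iff mem_proj algebra_simps)
  then have "(\<Union>h\<in>proj f. proj (const c * h)) = (\<Union>h\<in>proj f. proj (const c * f))"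
    by (intro SUP_cong refl)
  also have "\<dots> = proj (const c * f)"
  proof -
    have "proj f \<noteq> {}" using K_props(2) mem_proj by (metis diff_self empty_iff)
    then show ?thesis by simp
  qed
  finally show ?thesis
    by (simp add: alg_quot_def proj_def)
qed

lemma abelian_group_Q: "abelian_group Q"
proof (rule abelian_groupI)
  show "\<exists>y\<in>carrier Q. y \<oplus>\<^bsub>Q\<^esub> x = \<zero>\<^bsub>Q\<^esub>" if "x \<in> carrier Q" for x
  proof -
    from that obtain f where "f \<in> F" "x = proj f" by (auto simp: carrier_Q)
    then show ?thesis
      by (intro bexI[of _ "proj (- f)"]) (auto simp: add_Q zero_Q carrier_Q intro: free_alg_uminus)
  qed
qed (auto simp: carrier_Q zero_Q add_Q ac_simps intro: free_alg_closed)

sublocale Q: record_alg Q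
proof -
  interpret abelian_group Q by (rule abelian_group_Q)
  show "record_alg Q"
  proof
    fix x assume "x \<in> carrier Q"
    then obtain f where f: "f \<in> F" "x = proj f" by (auto simp: carrier_Q)
    have "\<ominus>\<^bsub>Q\<^esub> proj f = proj (- f)"
      using f by (intro minus_equality) (auto simp: add_Q zero_Q carrier_Q intro: free_alg_uminus)
    then show "\<ominus>\<^bsub>Q\<^esub> x = (- 1) \<odot>\<^bsub>Q\<^esub> x"
      by (simp add: f smult_Q single_uminus)
  qed (auto simp: carrier_Q smult_Q mult_Q intro: free_alg_closed)
qed

lemma proj_carrier: "f \<in> F \<Longrightarrow> proj f \<in> carrier Q"
  by (auto simp: carrier_Q)

lemma minus_Q: "f \<in> F \<Longrightarrow> g \<in> F \<Longrightarrow> proj f \<ominus>\<^bsub>Q\<^esub> proj g = proj (f - g)"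
  using Q.neg_smult[OF proj_carrier, of g] by (simp add: a_minus_def smult_Q add_Q single_uminus)

lemma finsum_Q:
  assumes "finite A" "\<And>i. i \<in> A \<Longrightarrow> h i \<in> F"
  shows "finsum Q (\<lambda>i. proj (h i)) A = proj (sum h A)"
  using assms
proof (induction A rule: finite_induct)
  case (insert i A)
  then show ?case
    by (subst Q.finsum_insert) (auto intro: proj_carrier simp: add_Q)
qed (simp add: zero_Q)

text \<open>Nonempty lists avoid the empty product, which is the unit for \<open>prod_list\<close>
  but the dummy zero for \<open>mult_list\<close>.\<close>

lemma mult_list_Q:
  assumes "gs \<noteq> []" "set gs \<subseteq> X"
  shows "mult_list Q (map (\<lambda>g. proj (var g)) gs) = proj (prod_list (map var gs))"
    and "prod_list (map var gs) \<in> F"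
  using assms
proof (induction gs rule: induct_list012)
  case (3 g h gs)
  {
    case 1
    with 3 show ?case by (auto simp: mult_Q free_alg_closed)
  next
    case 2
    with 3 show ?case by (auto intro: free_alg_closed)
  }
qed (auto intro: free_alg_closed)

section \<open>Lifting ideals to the unital free algebra\<close>

definition alien :: "('g list \<Rightarrow>\<^sub>0 'k) set" where
  "alien = {f. \<forall>w\<in>Poly_Mapping.keys f. \<not> set w \<subseteq> X}"

definition lift :: "('g list \<Rightarrow>\<^sub>0 'k) set set \<Rightarrow> ('g list \<Rightarrow>\<^sub>0 'k) set" where
  "lift I = {f + g | f g. f \<in> F \<and> proj f \<in> I \<and> g \<in> alien}"

lemma alien_two_sided: "two_sided alien"
  unfolding two_sided_def
proof (intro conjI ballI allI)
  show "x + y \<in> alien" if "x \<in> alien" "y \<in> alien" for x y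
    using that Poly_Mapping.keys_add[of x y] by (auto simp: alien_def)
  show "x * a \<in> alien" if "a \<in> alien" for a x
    using that Poly_Mapping.keys_mult[of x a] by (fastforce simp: alien_def plus_list_def)
  show "a * x \<in> alien" if "a \<in> alien" for a x
    using that Poly_Mapping.keys_mult[of a x] by (fastforce simp: alien_def plus_list_def)
qed (simp add: alien_def)

lemma lift_mono: "I \<subseteq> J \<Longrightarrow> lift I \<subseteq> lift J"
  unfolding lift_def by blast

lemma F_alien: "f \<in> F \<Longrightarrow> f \<in> alien \<Longrightarrow> f = 0"
  by (auto simp: free_alg_carrier alien_def simp flip: keys_eq_empty)

text \<open>Within \<open>F\<close> the lift is just the preimage of \<open>I\<close>: an alien
  summand of an element of \<open>F\<close> that leaves a remainder in \<open>F\<close> is itself in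
  \<open>F\<close>, hence zero.\<close>

lemma lift_iff:
  assumes "f \<in> F"
  shows "f \<in> lift I \<longleftrightarrow> proj f \<in> I"
proof
  assume "f \<in> lift I"
  then obtain g n where "f = g + n" "g \<in> F" "proj g \<in> I" "n \<in> alien"
    by (auto simp: lift_def)
  moreover from this have "n = 0"
    using F_alien[of n] free_alg_diff[OF assms, of g] by simp
  ultimately show "proj f \<in> I" by simp
next
  assume "proj f \<in> I"
  then show "f \<in> lift I"
    using assms two_sided_zero[OF alien_two_sided] by (force simp: lift_def)
qed

lemma lift_add:
  assumes "alg_ideal Q I" "x \<in> lift I" "y \<in> lift I"
  shows "x + y \<in> lift I"
proof -
  from assms(2,3) obtain f g f' g' where
    "x = f + g" "f \<in> F" "proj f \<in> I" "g \<in> alien" "y = f' + g'" "f' \<in> F" "proj f' \<in> I" "g' \<in> alien"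
    by (auto simp: lift_def)
  then have "x + y = (f + f') + (g + g')" "f + f' \<in> F" "proj (f + f') \<in> I" "g + g' \<in> alien"
    using Q.alg_idealD(3)[OF assms(1), of "proj f" "proj f'"]
    by (auto simp: add_Q intro: free_alg_add two_sided_add[OF alien_two_sided])
  then show ?thesis by (auto simp: lift_def)
qed

lemma alien_lift: "alg_ideal Q I \<Longrightarrow> x \<in> alien \<Longrightarrow> x \<in> lift I"
  using Q.alg_idealD(2)[of I] free_alg_zero[of X] by (force simp: lift_def zero_Q)

lemma lift_single:
  assumes I: "alg_ideal Q I" and x: "x \<in> lift I"
  shows "Poly_Mapping.single w c * x \<in> lift I" "x * Poly_Mapping.single w c \<in> lift I"
proof -
  let ?w = "Poly_Mapping.single w c"
  from x obtain f g where x: "x = f + g" and f: "f \<in> F" "proj f \<in> I" and g: "g \<in> alien"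
    by (auto simp: lift_def)
  have "?w * f \<in> lift I \<and> f * ?w \<in> lift I"
  proof -
    \<comment> \<open>The empty word acts as a scalar, a word over \<open>X\<close> is an element of
      \<open>F\<close>, and any other word makes the product alien.\<close>
    consider "w = 0" | "w \<noteq> []" "set w \<subseteq> X" | "\<not> set w \<subseteq> X" by (auto simp: zero_list_def)
    then show ?thesis
    proof cases
      case 1
      then show ?thesis
        using f Q.alg_idealD(4)[OF I, of "proj f" c]
        by (simp add: const_comm lift_iff free_alg_const smult_Q)
    next
      case 2
      then have "?w \<in> F" by (rule free_alg_single)
      then show ?thesis
        using f Q.alg_idealD(5,6)[OF I proj_carrier[of ?w], of "proj f"]
        by (simp add: lift_iff free_alg_mult mult_Q)
    next
      case 3
      then have "?w \<in> alien" by (auto simp: alien_def)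
      then show ?thesis
        using alien_lift[OF I] two_sided_left[OF alien_two_sided] two_sided_right[OF alien_two_sided]
        by blast
    qed
  qed
  moreover have "?w * g \<in> lift I" "g * ?w \<in> lift I"
    using alien_lift[OF I] two_sided_left[OF alien_two_sided g] two_sided_right[OF alien_two_sided g]
    by blast+
  ultimately show "?w * x \<in> lift I" "x * ?w \<in> lift I"
    unfolding x using lift_add[OF I] by (auto simp: distrib_left distrib_right)
qed

lemma two_sided_lift:
  assumes I: "alg_ideal Q I"
  shows "two_sided (lift I)"
proof -
  have zero: "0 \<in> lift I"
    using alien_lift[OF I two_sided_zero[OF alien_two_sided]] .
  have "z * x \<in> lift I \<and> x * z \<in> lift I" if "x \<in> lift I" for x z
    by (rule poly_mapping_keys_induct[of z UNIV])
      (auto simp: zero distrib_left distrib_right intro: lift_add[OF I] lift_single[OF I that])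
  then show ?thesis using zero lift_add[OF I] by (auto simp: two_sided_def)
qed

lemma alg_ideal_zero: "alg_ideal Q {\<zero>\<^bsub>Q\<^esub>}"
proof (intro Q.alg_idealI)
  show "x \<otimes>\<^bsub>Q\<^esub> a \<in> {\<zero>\<^bsub>Q\<^esub>}" "a \<otimes>\<^bsub>Q\<^esub> x \<in> {\<zero>\<^bsub>Q\<^esub>}"
    if "x \<in> carrier Q" "a \<in> {\<zero>\<^bsub>Q\<^esub>}" for x a
    using that by (auto simp: carrier_Q zero_Q mult_Q free_alg_zero)
qed (auto simp: zero_Q add_Q smult_Q carrier_Q intro: free_alg_zero)

text \<open>The modulus for all congruences: it agrees with \<open>K\<close> on \<open>F\<close> and
  is two-sided in the whole unital ring.\<close>

definition K' :: "('g list \<Rightarrow>\<^sub>0 'k) set" where "K' = lift {\<zero>\<^bsub>Q\<^esub>}"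

lemma two_sided_K': "two_sided K'"
  unfolding K'_def by (intro two_sided_lift alg_ideal_zero)

lemma K'_subset_lift: "alg_ideal Q I \<Longrightarrow> K' \<subseteq> lift I"
  unfolding K'_def using Q.alg_idealD(2)[of I] by (intro lift_mono) simp

lemma K'_iff: "f \<in> F \<Longrightarrow> f \<in> K' \<longleftrightarrow> f \<in> K"
  using proj_eq_iff[of f 0] by (simp add: K'_def lift_iff zero_Q)

lemma K_subset_K': "K \<subseteq> K'"
  using K'_iff K_props(1) by blast

lemma proj_eq_K': "f \<in> F \<Longrightarrow> g \<in> F \<Longrightarrow> f - g \<in> K' \<Longrightarrow> proj f = proj g"
  using K'_iff[OF free_alg_diff] proj_eq_iff by blast

text \<open>The way back from ideals of the unital ring to ideals of \<open>Q\<close>; needed to see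
  that sums of homogeneous elements form an ideal there.\<close>

lemma alg_ideal_proj:
  assumes "two_sided M"
  shows "alg_ideal Q (proj ` (F \<inter> M))"
proof (intro Q.alg_idealI)
  show "\<zero>\<^bsub>Q\<^esub> \<in> proj ` (F \<inter> M)"
    using two_sided_zero[OF assms] free_alg_zero by (auto simp: zero_Q)
  show "x \<oplus>\<^bsub>Q\<^esub> y \<in> proj ` (F \<inter> M)" if "x \<in> proj ` (F \<inter> M)" "y \<in> proj ` (F \<inter> M)" for x y
    using that two_sided_add[OF assms] by (auto simp: add_Q intro!: imageI free_alg_add)
  show "c \<odot>\<^bsub>Q\<^esub> x \<in> proj ` (F \<inter> M)" if "x \<in> proj ` (F \<inter> M)" for c x
    using that two_sided_left[OF assms] by (auto simp: smult_Q intro!: imageI free_alg_const)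
  show "x \<otimes>\<^bsub>Q\<^esub> a \<in> proj ` (F \<inter> M)" "a \<otimes>\<^bsub>Q\<^esub> x \<in> proj ` (F \<inter> M)"
    if "x \<in> carrier Q" "a \<in> proj ` (F \<inter> M)" for x a
    using that two_sided_left[OF assms] two_sided_right[OF assms]
    by (auto simp: carrier_Q mult_Q intro!: imageI free_alg_mult)
qed (auto simp: carrier_Q)

end


section \<open>Homogeneous elements\<close>

context leavitt_mod
begin

text \<open>At the first break in the list two consecutive edges multiply to zero. This reconciles
  monomials over arbitrary lists with those over paths.\<close>

lemma s_list_zero:
  assumes "set \<alpha> \<subseteq> edges G" "\<not> successively (\<lambda>e f. src G f \<in> rng G e) \<alpha>"
  shows "prod_list (map s \<alpha>) \<approx> 0"
  using assms
proof (induction \<alpha> rule: induct_list012)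
  case (3 e f \<gamma>)
  show ?case
  proof (cases "src G f \<in> rng G e")
    case True
    then have "prod_list (map s (f # \<gamma>)) \<approx> 0" using 3 by auto
    from eqv_left[OF this, of "s e"] show ?thesis by simp
  next
    case False
    then have "s e * s f \<approx> 0" using 3 by (intro s_s_zero) auto
    from eqv_right[OF this, of "prod_list (map s \<gamma>)"] show ?thesis by (simp add: mult.assoc)
  qed
qed auto

lemma t_list_zero:
  assumes "set \<beta> \<subseteq> edges G" "\<not> successively (\<lambda>e f. src G f \<in> rng G e) \<beta>"
  shows "prod_list (map t (rev \<beta>)) \<approx> 0"
  using assms
proof (induction \<beta> rule: induct_list012)
  case (3 e f \<gamma>)
  show ?case
  proof (cases "src G f \<in> rng G e")
    case True
    then have "prod_list (map t (rev (f # \<gamma>))) \<approx> 0" using 3 by auto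
    from eqv_right[OF this, of "t e"] show ?thesis by (simp add: mult.assoc)
  next
    case False
    then have "t f * t e \<approx> 0" using 3 by (intro t_t_zero) auto
    from eqv_left[OF this, of "prod_list (map t (rev \<gamma>))"] show ?thesis by (simp add: mult.assoc)
  qed
qed auto

lemma mspan_uminus: "x \<in> mspan P \<Longrightarrow> - x \<in> mspan P"
proof -
  have "scal (- 1) = - 1"
    using scal_add[of "- 1" 1] by (simp add: scal_0 scal_1 eq_neg_iff_add_eq_0)
  then show "x \<in> mspan P \<Longrightarrow> - x \<in> mspan P" using mspan_scal[of x P "- 1"] by simp
qed

lemma mspan_sum: "(\<And>i. i \<in> A \<Longrightarrow> f i \<in> mspan P) \<Longrightarrow> sum f A \<in> mspan P"
  by (induction A rule: infinite_finite_induct) (auto intro: mspan_zero mspan.add)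

lemma mspan_gap:
  assumes "A \<in> gen_verts G" "S \<subseteq> edges G"
  shows "gap A S \<in> mspan (degree 0)"
proof -
  have "p A \<in> mspan (degree 0)"
    using mspan_mono1[of A "[]" "[]" "degree 0"] assms by (simp add: mono_Nil)
  moreover have "s e * t e \<in> mspan (degree 0)" if "e \<in> S" for e
  proof -
    have e: "e \<in> edges G" using that assms by auto
    \<comment> \<open>Inserting the range projection exhibits \<open>s e * t e\<close> as a monomial
      with one edge on each side.\<close>
    have eq: "mono [e] (rng G e) [e] \<approx> s e * t e"
      using eqv_right[OF edge_rng[OF e]] by (simp add: mono_Cons_left mono_Cons_right mono_Nil flip: mult.assoc)
    show ?thesis
      using mspan_mono1[of "rng G e" "[e]" "[e]" "degree 0"] e by (intro mspan_eqv[OF _ eq]) auto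
  qed
  ultimately have "p A + - edge_proj S \<in> mspan (degree 0)"
    unfolding edge_proj_def by (intro mspan.add mspan_uminus mspan_sum)
  then show ?thesis by (simp add: gap_def)
qed

text \<open>Finite sums of homogeneous elements of \<open>M\<close>, modulo \<open>K\<close>. The
  degree \<open>n\<close> may change from step to step. For \<open>M\<close> the lift of an ideal,
  containing that lift is what gradedness amounts to.\<close>

inductive_set hspan :: "'a set \<Rightarrow> 'a set" for M :: "'a set" where
  kernel: "x \<in> K \<Longrightarrow> x \<in> hspan M"
| step: "x \<in> M \<Longrightarrow> x \<in> mspan (degree n) \<Longrightarrow> y \<in> hspan M \<Longrightarrow> x + y \<in> hspan M"

lemma hspan_add: "x \<in> hspan M \<Longrightarrow> y \<in> hspan M \<Longrightarrow> x + y \<in> hspan M"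
proof (induction rule: hspan.induct)
  case (kernel x)
  from kernel(2,1) show ?case
  proof (induction rule: hspan.induct)
    case (kernel y)
    then show ?case by (intro hspan.kernel two_sided_add[OF two_sided_K])
  next
    case (step y n z)
    then have "y + (x + z) \<in> hspan M" by (intro hspan.step[of y M n]) auto
    then show ?case by (simp add: algebra_simps)
  qed
next
  case (step x n z)
  then have "x + (z + y) \<in> hspan M" by (intro hspan.step[of x M n]) auto
  then show ?case by (simp add: add.assoc)
qed

text \<open>Stated for multipliers preserving homogeneity, such as scalars and generators; general
  multipliers are composed of these.\<close>

lemma hspan_left:
  assumes M: "two_sided M" and z: "\<And>x n. x \<in> mspan (degree n) \<Longrightarrow> \<exists>m. z * x \<in> mspan (degree m)"
    and "x \<in> hspan M"
  shows "z * x \<in> hspan M"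
  using assms(3)
proof (induction rule: hspan.induct)
  case (kernel x)
  then show ?case by (intro hspan.kernel two_sided_left[OF two_sided_K])
next
  case (step x n y)
  then obtain m where "z * x \<in> mspan (degree m)" using z by blast
  then show ?case
    using step two_sided_left[OF M] by (auto simp: distrib_left intro: hspan.step)
qed

lemma hspan_right:
  assumes M: "two_sided M" and z: "\<And>x n. x \<in> mspan (degree n) \<Longrightarrow> \<exists>m. x * z \<in> mspan (degree m)"
    and "x \<in> hspan M"
  shows "x * z \<in> hspan M"
  using assms(3)
proof (induction rule: hspan.induct)
  case (kernel x)
  then show ?case by (intro hspan.kernel two_sided_right[OF two_sided_K])
next
  case (step x n y)
  then obtain m where "x * z \<in> mspan (degree m)" using z by blast
  then show ?case
    using step two_sided_right[OF M] by (auto simp: distrib_right intro: hspan.step)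
qed

end


section \<open>The Leavitt path algebra as a quotient\<close>

text \<open>The type of \<open>G\<close> does not mention the field, so a type token fixes
  it.\<close>

locale lpa_over = ultragraph G for G :: "('v, 'e) ultragraph" +
  fixes scalars :: "'k::field itself"
begin

lemma Proj_gens [simp]: "Proj A \<in> gens G \<longleftrightarrow> A \<in> gen_verts G"
  and Edge_gens [simp]: "Edge e \<in> gens G \<longleftrightarrow> e \<in> edges G"
  and Ghost_gens [simp]: "Ghost e \<in> gens G \<longleftrightarrow> e \<in> edges G"
  by (auto simp: gens_def)

lemma lpa_rels_carrier:
  "(x, y) \<in> lpa_rels G \<Longrightarrow> x - y \<in> (carrier (free_alg (gens G)) :: ('v, 'e, 'k) free_elem set)"
proof (induction x y rule: lpa_rels.induct)
  case (regular v)
  then show ?case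
    by (intro free_alg_closed) (auto simp: regular_vertex_def out_edges_def gen_verts.intros)
qed (auto intro!: free_alg_closed simp: gen_verts.intros src_in_verts)

lemma alg_ideal_kernel:
  "alg_ideal (free_alg (gens G)) (lpa_kernel G :: ('v, 'e, 'k) free_elem set)"
  unfolding lpa_kernel_def using lpa_rels_carrier
  by (intro record_alg.alg_ideal_gen[OF record_alg_free_alg]) blast

sublocale fq: free_quot "gens G" "lpa_kernel G :: ('v, 'e, 'k) free_elem set"
  by (intro free_quot.intro alg_ideal_kernel)

abbreviation p' :: "'v set \<Rightarrow> ('v, 'e, 'k) free_elem" where "p' A \<equiv> var (Proj A)"
abbreviation s' :: "'e \<Rightarrow> ('v, 'e, 'k) free_elem" where "s' e \<equiv> var (Edge e)"
abbreviation t' :: "'e \<Rightarrow> ('v, 'e, 'k) free_elem" where "t' e \<equiv> var (Ghost e)"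

sublocale leavitt_mod G fq.K' const p' s' t'
proof -
  interpret ring_mod fq.K' by (intro ring_mod.intro fq.two_sided_K')
  \<comment> \<open>Each relation holds modulo \<open>lpa_kernel G\<close>, hence modulo the larger
    set \<open>fq.K'\<close>.\<close>
  have rel: "eqv x y" if "(x, y) \<in> lpa_rels G" for x y
  proof -
    have "x - y \<in> lpa_kernel G"
      unfolding lpa_kernel_def by (rule subsetD[OF ideal_gen_superset]) (use that in blast)
    then show ?thesis using fq.K_subset_K' by (auto simp: eqv_def)
  qed
  show "leavitt_mod G fq.K' const p' s' t'"
  proof
    show "const (c + d) = const c + const d" for c d :: 'k by (rule single_add)
    show "const (c * d) = const c * const d" for c d :: 'k by (simp add: const_left_single)
    show "x * const c = const c * x" for c :: 'k and x :: "('v, 'e, 'k) free_elem" by (rule const_comm)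
  qed (simp, (rule rel, rule lpa_rels.intros; assumption)+)
qed

notation eqv (infix "\<approx>" 50)

abbreviation L :: "('k, ('v, 'e, 'k) lpa_elem) module" where "L \<equiv> LPA G"

lemma L_eq: "L = fq.Q"
  by (simp add: LPA_def)

lemma lpa_gen_eq: "lpa_gen G g = fq.proj (var g)"
  by (simp add: lpa_gen_def fq.proj_def)

lemma gap_F:
  assumes "A \<in> gen_verts G" "S \<subseteq> edges G"
  shows "gap A S \<in> fq.F"
  using assms unfolding gap_def edge_proj_def by (intro free_alg_closed) auto

lemma lpa_gap_eq:
  assumes "A \<in> gen_verts G" "finite S" "S \<subseteq> edges G"
  shows "lpa_gap G A S = fq.proj (gap A S)"
proof -
  have st: "s' e \<in> fq.F" "t' e \<in> fq.F" "s' e * t' e \<in> fq.F" if "e \<in> S" for e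
  proof -
    have "e \<in> edges G" using that assms(3) by blast
    then show "s' e \<in> fq.F" "t' e \<in> fq.F" "s' e * t' e \<in> fq.F"
      by (intro free_alg_mult free_alg_var; simp)+
  qed
  have "finsum L (\<lambda>e. lpa_s G e \<otimes>\<^bsub>L\<^esub> lpa_s_star G e) S = finsum L (\<lambda>e. fq.proj (s' e * t' e)) S"
    unfolding L_eq using assms(3)
    by (intro fq.Q.finsum_cong')
      (auto simp: lpa_s_def lpa_s_star_def lpa_gen_eq fq.mult_Q st intro!: fq.proj_carrier st)
  also have "\<dots> = fq.proj (edge_proj S)"
    unfolding L_eq edge_proj_def using assms by (intro fq.finsum_Q st)
  finally show ?thesis
    using assms gap_F[of A S]
    by (auto simp: lpa_gap_def Let_def lpa_p_def lpa_gen_eq gap_def edge_proj_def L_eq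
        intro!: fq.minus_Q free_alg_closed)
qed

lemma lpa_pH_eq:
  assumes "v \<in> breaking G H"
  shows "lpa_pH G H v = fq.proj (gap {v} {e \<in> out_edges G v. rng G e \<notin> H})"
    and "gap {v} {e \<in> out_edges G v. rng G e \<notin> H} \<in> fq.F"
proof -
  have *: "{v} \<in> gen_verts G" "finite {e \<in> out_edges G v. rng G e \<notin> H}"
    "{e \<in> out_edges G v. rng G e \<notin> H} \<subseteq> edges G"
    using assms by (auto simp: breaking_def out_edges_def)
  show "lpa_pH G H v = fq.proj (gap {v} {e \<in> out_edges G v. rng G e \<notin> H})"
    unfolding lpa_pH_def by (rule lpa_gap_eq[OF *])
  show "gap {v} {e \<in> out_edges G v. rng G e \<notin> H} \<in> fq.F"
    by (rule gap_F[OF *(1,3)])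
qed

section \<open>Paths and the homogeneous components\<close>

fun path_elem :: "('v, 'e) path \<Rightarrow> ('v, 'e, 'k) free_elem" where
  "path_elem (SetPath A) = p' A"
| "path_elem (EdgePath \<alpha>) = prod_list (map s' \<alpha>)"

fun path_star_elem :: "('v, 'e) path \<Rightarrow> ('v, 'e, 'k) free_elem" where
  "path_star_elem (SetPath A) = p' A"
| "path_star_elem (EdgePath \<alpha>) = prod_list (map t' (rev \<alpha>))"

lemma prod_list_F:
  assumes "gs \<noteq> []" "set gs \<subseteq> gens G"
  shows "prod_list (map var gs) \<in> fq.F"
  using fq.mult_list_Q(2)[OF assms] .

lemma path_eq:
  assumes "\<alpha> \<in> paths G"
  shows "lpa_path G \<alpha> = fq.proj (path_elem \<alpha>)" "path_elem \<alpha> \<in> fq.F"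
    and "lpa_path_star G \<alpha> = fq.proj (path_star_elem \<alpha>)" "path_star_elem \<alpha> \<in> fq.F"
proof -
  have "lpa_path G \<alpha> = fq.proj (path_elem \<alpha>) \<and> path_elem \<alpha> \<in> fq.F \<and>
    lpa_path_star G \<alpha> = fq.proj (path_star_elem \<alpha>) \<and> path_star_elem \<alpha> \<in> fq.F"
  proof (cases \<alpha>)
    case (SetPath A)
    then show ?thesis
      using assms by (auto simp: paths_def lpa_p_def lpa_gen_eq intro: free_alg_closed)
  next
    case (EdgePath es)
    then have es: "es \<noteq> []" "set es \<subseteq> edges G" using assms by (auto simp: paths_def)
    let ?s = "map Edge es" and ?t = "map Ghost (rev es)"
    have st: "?s \<noteq> []" "set ?s \<subseteq> gens G" "?t \<noteq> []" "set ?t \<subseteq> gens G" using es by auto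
    show ?thesis
      using fq.mult_list_Q[OF st(1,2)] fq.mult_list_Q[OF st(3,4)]
      by (simp add: EdgePath L_eq lpa_s_def[abs_def] lpa_s_star_def[abs_def] lpa_gen_eq comp_def rev_map)
  qed
  then show "lpa_path G \<alpha> = fq.proj (path_elem \<alpha>)" "path_elem \<alpha> \<in> fq.F"
    "lpa_path_star G \<alpha> = fq.proj (path_star_elem \<alpha>)" "path_star_elem \<alpha> \<in> fq.F" by auto
qed

lemma path_monomial_eq:
  assumes "\<alpha> \<in> paths G" "\<beta> \<in> paths G" "A \<in> gen_verts G"
  shows "lpa_path G \<alpha> \<otimes>\<^bsub>L\<^esub> lpa_p G A \<otimes>\<^bsub>L\<^esub> lpa_path_star G \<beta> =
      fq.proj (path_elem \<alpha> * p' A * path_star_elem \<beta>)"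
    and "path_elem \<alpha> * p' A * path_star_elem \<beta> \<in> fq.F"
  using path_eq[OF assms(1)] path_eq[OF assms(2)] assms(3)
  by (auto simp: lpa_p_def lpa_gen_eq L_eq fq.mult_Q free_alg_closed)

lemma path_monomial_component:
  assumes "\<alpha> \<in> paths G" "\<beta> \<in> paths G" "A \<in> gen_verts G"
    and "int (path_length \<alpha>) - int (path_length \<beta>) = n"
  shows "fq.proj (path_elem \<alpha> * p' A * path_star_elem \<beta>) \<in> lpa_component G n"
  unfolding path_monomial_eq(1)[OF assms(1-3), symmetric] lpa_component_def Let_def
  by (rule subsetD[OF lin_span_superset], rule CollectI, intro exI conjI, rule refl) (use assms in simp_all)

text \<open>A path of length zero contributes only a projection, and multiplying a monomial span by
  a projection preserves it.\<close>

lemma path_monomial_mspan: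
  assumes "\<alpha> \<in> paths G" "\<beta> \<in> paths G" "A \<in> gen_verts G"
    and "int (path_length \<alpha>) - int (path_length \<beta>) = n"
  shows "path_elem \<alpha> * p' A * path_star_elem \<beta> \<in> mspan (degree n)"
proof (cases \<alpha>)
  case (SetPath C)
  then have C: "C \<in> gen_verts G" using assms by (auto simp: paths_def)
  show ?thesis
  proof (cases \<beta>)
    case SP: (SetPath D)
    then have D: "D \<in> gen_verts G" using assms by (auto simp: paths_def)
    have "p' C * mono [] A [] * p' D \<in> mspan (degree n)"
      using assms SetPath SP by (intro mspan_p_right mspan_p_left mspan_mono1 C D) auto
    then show ?thesis by (simp add: SetPath SP mono_Nil)
  next
    case (EdgePath es)
    then have es: "set es \<subseteq> edges G" using assms by (auto simp: paths_def)
    have "p' C * mono [] A es \<in> mspan (degree n)"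
      using assms SetPath EdgePath es by (intro mspan_p_left mspan_mono1 C) auto
    then show ?thesis by (simp add: SetPath EdgePath mono_def mult.assoc)
  qed
next
  case (EdgePath ds)
  then have ds: "set ds \<subseteq> edges G" using assms by (auto simp: paths_def)
  show ?thesis
  proof (cases \<beta>)
    case (SetPath D)
    then have D: "D \<in> gen_verts G" using assms by (auto simp: paths_def)
    have "mono ds A [] * p' D \<in> mspan (degree n)"
      using assms SetPath EdgePath ds by (intro mspan_p_right mspan_mono1 D) auto
    then show ?thesis by (simp add: SetPath EdgePath mono_def)
  next
    case EP: (EdgePath es)
    then have es: "set es \<subseteq> edges G" using assms by (auto simp: paths_def)
    have "mono ds A es \<in> mspan (degree n)"
      using assms EdgePath EP ds es by (intro mspan_mono1) auto
    then show ?thesis by (simp add: EdgePath EP mono_def)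
  qed
qed

text \<open>The image on the right is a linear subspace, so it is enough to place the spanning
  products in it. The converse comparison is \<open>mspan_component\<close>.\<close>

lemma component_subset: "lpa_component G n \<subseteq> fq.proj ` (fq.F \<inter> mspan (degree n))"
proof -
  let ?W = "fq.proj ` (fq.F \<inter> mspan (degree n))"
  have "lin_subspace L ?W"
    unfolding L_eq
  proof (rule fq.Q.lin_subspaceI)
    show "\<zero>\<^bsub>fq.Q\<^esub> \<in> ?W"
      using free_alg_zero mspan_zero by (auto simp: fq.zero_Q)
  qed (auto simp: fq.carrier_Q fq.add_Q fq.smult_Q
      intro!: imageI free_alg_add free_alg_const mspan.add mspan_scal)
  then show ?thesis
    unfolding lpa_component_def Let_def
    by (rule lin_span_least) (use path_monomial_eq path_monomial_mspan in force)
qed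

lemma lin_subspace_component: "lin_subspace fq.Q (lpa_component G n :: ('v, 'e, 'k) lpa_elem set)"
  unfolding lpa_component_def Let_def L_eq
  by (intro fq.Q.lin_subspace_span)
    (use path_monomial_eq fq.proj_carrier in \<open>force simp flip: L_eq\<close>)

lemma mono_F:
  assumes "A \<in> gen_verts G" "set \<alpha> \<subseteq> edges G" "set \<beta> \<subseteq> edges G"
  shows "mono \<alpha> A \<beta> \<in> fq.F"
proof -
  let ?gs = "map Edge \<alpha> @ Proj A # map Ghost (rev \<beta>)"
  have "set ?gs \<subseteq> gens G" using assms by auto
  then have "prod_list (map var ?gs) \<in> fq.F" by (intro prod_list_F) simp_all
  then show ?thesis by (simp add: mono_def comp_def mult.assoc)
qed

text \<open>If both lists are paths or empty, the monomial is one of the spanning products up to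
  congruence; otherwise a broken list makes it zero.\<close>

lemma mono_component:
  assumes "A \<in> gen_verts G" "set \<alpha> \<subseteq> edges G" "set \<beta> \<subseteq> edges G"
    and "degree n (length \<alpha>) (length \<beta>)"
  shows "fq.proj (mono \<alpha> A \<beta>) \<in> lpa_component G n"
proof (cases "successively (\<lambda>e f. src G f \<in> rng G e) \<alpha> \<and> successively (\<lambda>e f. src G f \<in> rng G e) \<beta>")
  case True
  \<comment> \<open>The empty list is not a path; \<open>A\<close> itself serves as the path of
    length zero, and the extra factor \<open>p' A\<close> is absorbed by idempotence.\<close>
  define path where "path es = (if es = [] then SetPath A else EdgePath es)" for es :: "'e list"
  have path: "path es \<in> paths G" "path_length (path es) = length es"
    if "set es \<subseteq> edges G" "successively (\<lambda>e f. src G f \<in> rng G e) es" for es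
    using that assms(1) by (auto simp: path_def paths_def successively_conv_nth)
  have pp: "p' A * p' A \<approx> p' A" using p_subset assms(1) by blast
  have l: "path_elem (path \<alpha>) * p' A \<approx> prod_list (map s' \<alpha>) * p' A"
    using pp by (simp add: path_def)
  have r: "p' A * path_star_elem (path \<beta>) \<approx> p' A * prod_list (map t' (rev \<beta>))"
    using pp by (simp add: path_def)
  have "path_elem (path \<alpha>) * p' A * path_star_elem (path \<beta>)
      \<approx> prod_list (map s' \<alpha>) * p' A * path_star_elem (path \<beta>)"
    by (intro eqv_right l)
  also have "\<dots> = prod_list (map s' \<alpha>) * (p' A * path_star_elem (path \<beta>))"
    by (simp add: mult.assoc)
  also have "\<dots> \<approx> prod_list (map s' \<alpha>) * (p' A * prod_list (map t' (rev \<beta>)))"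
    by (intro eqv_left r)
  also have "\<dots> = mono \<alpha> A \<beta>" by (simp add: mono_def mult.assoc)
  finally have "fq.proj (path_elem (path \<alpha>) * p' A * path_star_elem (path \<beta>)) = fq.proj (mono \<alpha> A \<beta>)"
    unfolding eqv_def using path assms True by (intro fq.proj_eq_K' path_monomial_eq mono_F) auto
  moreover have "fq.proj (path_elem (path \<alpha>) * p' A * path_star_elem (path \<beta>)) \<in> lpa_component G n"
    using path[of \<alpha>] path[of \<beta>] True assms by (intro path_monomial_component) auto
  ultimately show ?thesis by simp
next
  case False
  have "mono \<alpha> A \<beta> \<approx> 0"
  proof (cases "successively (\<lambda>e f. src G f \<in> rng G e) \<alpha>")
    case True
    then have "prod_list (map t' (rev \<beta>)) \<approx> 0" using False assms by (intro t_list_zero) auto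
    from eqv_left[OF this, of "prod_list (map s' \<alpha>) * p' A"] show ?thesis by (simp add: mono_def)
  next
    case False
    then have "prod_list (map s' \<alpha>) \<approx> 0" using assms by (intro s_list_zero) auto
    from eqv_right[OF this, of "p' A * prod_list (map t' (rev \<beta>))"] show ?thesis
      by (simp add: mono_def mult.assoc)
  qed
  then have "fq.proj (mono \<alpha> A \<beta>) = fq.proj 0"
    unfolding eqv_def using assms by (intro fq.proj_eq_K' mono_F free_alg_zero)
  then show ?thesis
    using fq.Q.lin_subspaceD(2)[OF lin_subspace_component] by (simp add: fq.zero_Q)
qed

text \<open>Elements of the span may contain alien words through \<open>fq.K'\<close>, so a
  representative in \<open>fq.F\<close> is found only up to congruence.\<close>

lemma mspan_component:
  assumes "x \<in> mspan (degree n)"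
  shows "\<exists>f\<in>fq.F. fq.proj f \<in> lpa_component G n \<and> x \<approx> f"
  using assms
proof (induction rule: mspan.induct)
  case (kernel x)
  then show ?case
    using fq.Q.lin_subspaceD(2)[OF lin_subspace_component[of n]]
    by (intro bexI[of _ 0]) (auto simp: fq.zero_Q eqv_zero_iff free_alg_zero)
next
  case (mono A \<alpha> \<beta> c)
  then show ?case
    using fq.Q.lin_subspaceD(4)[OF lin_subspace_component[of n] mono_component[of A \<alpha> \<beta> n], of c]
    by (intro bexI[of _ "const c * local.mono \<alpha> A \<beta>"]) (auto simp: fq.smult_Q intro: free_alg_const mono_F)
next
  case (add x y)
  then obtain f g where "f \<in> fq.F" "fq.proj f \<in> lpa_component G n" "x \<approx> f"
    "g \<in> fq.F" "fq.proj g \<in> lpa_component G n" "y \<approx> g" by blast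
  then show ?case
    using fq.Q.lin_subspaceD(3)[OF lin_subspace_component[of n], of "fq.proj f" "fq.proj g"]
    by (intro bexI[of _ "f + g"]) (auto simp: fq.add_Q intro: free_alg_add eqv_add)
qed

section \<open>Graded ideals\<close>

lemma lpa_p_mem_iff: "A \<in> gen_verts G \<Longrightarrow> lpa_p G A \<in> I \<longleftrightarrow> p' A \<in> fq.lift I"
  by (simp add: lpa_p_def lpa_gen_eq fq.lift_iff free_alg_var)

text \<open>Homogeneous elements of \<open>I\<close> reach the generated ideal through
  \<open>homogeneous_mem\<close>, applied to the two lifts; gradedness writes any other element as a
  sum of these.\<close>

lemma graded_ideal_subset:
  fixes I :: "('v, 'e, 'k) lpa_elem set"
  defines "Y \<equiv> lpa_p G ` H_of G I \<union> lpa_pH G (H_of G I) ` S_of G I"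
  assumes I: "graded_ideal G I"
  shows "I \<subseteq> ideal_gen L Y"
proof
  have ideal_I: "alg_ideal fq.Q I"
    using I by (simp add: graded_ideal_def Let_def L_eq)
  define J where "J = ideal_gen L Y"
  have "Y \<subseteq> I" by (auto simp: Y_def H_of_def S_of_def)
  then have ideal_J: "alg_ideal fq.Q J"
    using fq.Q.alg_idealD(1)[OF ideal_I] unfolding J_def L_eq by (intro fq.Q.alg_ideal_gen) auto
  have Y_J: "Y \<subseteq> J" unfolding J_def by (rule ideal_gen_superset)
  have H: "{A \<in> gen_verts G. p' A \<in> fq.lift I} = H_of G I"
    by (auto simp: H_of_def lpa_p_mem_iff)
  have hom: "x \<in> J" if x: "x \<in> I" "x \<in> lpa_component G n" for x n
  proof -
    from x(2) obtain f where f: "f \<in> fq.F" "f \<in> mspan (degree n)" "x = fq.proj f"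
      using component_subset by blast
    have "f \<in> fq.lift J"
    proof (rule homogeneous_mem)
      show "two_sided (fq.lift I)" "fq.K' \<subseteq> fq.lift I" "two_sided (fq.lift J)" "fq.K' \<subseteq> fq.lift J"
        by (intro fq.two_sided_lift fq.K'_subset_lift ideal_I ideal_J)+
      show "p' A \<in> fq.lift J" if "A \<in> gen_verts G" "p' A \<in> fq.lift I" for A
        using that Y_J by (auto simp: Y_def H_of_def simp flip: lpa_p_mem_iff)
      show "gap {v} {e \<in> out_edges G v. rng G e \<notin> H} \<in> fq.lift J"
        if "H = {A \<in> gen_verts G. p' A \<in> fq.lift I}" and v: "v \<in> breaking G H"
          and "gap {v} {e \<in> out_edges G v. rng G e \<notin> H} \<in> fq.lift I" for v H
      proof -
        have H: "H = H_of G I" using that H by simp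
        then have "lpa_pH G H v \<in> Y"
          using that lpa_pH_eq[OF v] fq.lift_iff by (auto simp: Y_def S_of_def)
        then show ?thesis using Y_J lpa_pH_eq[OF v] fq.lift_iff by auto
      qed
      show "f \<in> fq.lift I" using x f fq.lift_iff by auto
    qed (rule f)
    then show ?thesis using f fq.lift_iff by auto
  qed
  fix x assume "x \<in> I"
  then obtain N y where y: "finite N" "\<forall>n\<in>N. y n \<in> I \<inter> lpa_component G n" "x = finsum fq.Q y N"
    using I unfolding graded_ideal_def Let_def L_eq by blast
  \<comment> \<open>The sum is built up over subsets of \<open>N\<close>, where the conditions on
    the summands remain available.\<close>
  have "finsum fq.Q y M \<in> J" if "M \<subseteq> N" for M
    using finite_subset[OF that y(1)] that
  proof (induction M rule: finite_induct)
    case empty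
    then show ?case using fq.Q.alg_idealD(2)[OF ideal_J] by simp
  next
    case (insert n M)
    then have "y n \<in> J" "\<And>m. m \<in> insert n M \<Longrightarrow> y m \<in> carrier fq.Q"
      using y hom fq.Q.alg_idealD(1)[OF ideal_I] by auto
    then show ?case
      using insert fq.Q.alg_idealD(3)[OF ideal_J] by (subst fq.Q.finsum_insert) auto
  qed
  then show "x \<in> ideal_gen L Y" using y by (auto simp: J_def)
qed

text \<open>Scalars and single symbols preserve homogeneity; absorption extends from them to words
  by induction on length and then to all elements by additivity.\<close>

lemma two_sided_hspan:
  assumes M: "two_sided M"
  shows "two_sided (hspan M)"
proof -
  have zero: "0 \<in> hspan M"
    by (intro hspan.kernel two_sided_zero fq.two_sided_K')
  have const: "const c * x \<in> hspan M" if "x \<in> hspan M" for c x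
    by (rule hspan_left[OF M _ that]) (auto intro: mspan_scal)
  \<comment> \<open>Symbols that are not generators are alien, so products with them lie in
    \<open>fq.K'\<close> and count as homogeneous of any degree.\<close>
  have var_K': "var g \<in> fq.K'" if "g \<notin> gens G" for g
    using that unfolding fq.K'_def
    by (intro fq.alien_lift fq.alg_ideal_zero) (auto simp: fq.alien_def var_def)
  have left: "var g * x \<in> hspan M" if "x \<in> hspan M" for g x
  proof (rule hspan_left[OF M _ that])
    fix x n assume x: "x \<in> mspan (degree n)"
    show "\<exists>m. var g * x \<in> mspan (degree m)"
    proof (cases "g \<in> gens G")
      case True
      then show ?thesis
        using mspan_p_left[OF x] mspan_s_left[OF x] mspan_t_left[OF x] by (cases g) auto
    next
      case False
      then show ?thesis
        using mspan.kernel[OF two_sided_right[OF fq.two_sided_K' var_K']] by blast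
    qed
  qed
  have right: "x * var g \<in> hspan M" if "x \<in> hspan M" for g x
  proof (rule hspan_right[OF M _ that])
    fix x n assume x: "x \<in> mspan (degree n)"
    show "\<exists>m. x * var g \<in> mspan (degree m)"
    proof (cases "g \<in> gens G")
      case True
      then show ?thesis
        using mspan_p_right[OF x] mspan_s_right[OF x] mspan_t_right[OF x] by (cases g) auto
    next
      case False
      then show ?thesis
        using mspan.kernel[OF two_sided_left[OF fq.two_sided_K' var_K']] by blast
    qed
  qed
  have single: "Poly_Mapping.single w c * x \<in> hspan M \<and> x * Poly_Mapping.single w c \<in> hspan M"
    if "x \<in> hspan M" for w c x
    using that
  proof (induction w arbitrary: x)
    case Nil
    then show ?case using const by (simp add: const_comm flip: zero_list_def)
  next
    case (Cons g w)
    have "Poly_Mapping.single (g # w) c = var g * Poly_Mapping.single w c"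
      by (simp add: var_def mult_single plus_list_def)
    then show ?case
      using Cons left right by (simp add: mult.assoc) (simp flip: mult.assoc)
  qed
  have "z * x \<in> hspan M \<and> x * z \<in> hspan M" if "x \<in> hspan M" for x z
    by (rule poly_mapping_keys_induct[of z UNIV])
      (auto simp: zero single[OF that] distrib_left distrib_right intro: hspan_add)
  then show ?thesis using zero hspan_add by (auto simp: two_sided_def)
qed

definition graded_sums :: "('v, 'e, 'k) lpa_elem set \<Rightarrow> ('v, 'e, 'k) lpa_elem set" where
  "graded_sums I =
     {x. \<exists>N y. finite N \<and> (\<forall>n\<in>N. y n \<in> I \<inter> lpa_component G n) \<and> x = finsum fq.Q y N}"

text \<open>\<open>graded_sums\<close> allows one summand per degree, so the new element is merged
  with the summand already present in degree \<open>n\<close>.\<close>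

lemma graded_sums_add:
  assumes I: "alg_ideal fq.Q I" and x: "x \<in> I" "x \<in> lpa_component G n" and z: "z \<in> graded_sums I"
  shows "x \<oplus>\<^bsub>fq.Q\<^esub> z \<in> graded_sums I"
proof -
  obtain N y where y: "finite N" "\<forall>n\<in>N. y n \<in> I \<inter> lpa_component G n" "z = finsum fq.Q y N"
    using z by (auto simp: graded_sums_def)
  note I_carrier = subsetD[OF fq.Q.alg_idealD(1)[OF I]]
  have yN: "y m \<in> carrier fq.Q" if "m \<in> N" for m
    using y that I_carrier by blast
  \<comment> \<open>The summand of degree \<open>n\<close>, or zero when \<open>n\<close> does not
    occur.\<close>
  define y0 where "y0 = (if n \<in> N then y n else \<zero>\<^bsub>fq.Q\<^esub>)"
  have y0: "y0 \<in> I" "y0 \<in> lpa_component G n"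
    using y fq.Q.alg_idealD(2)[OF I] fq.Q.lin_subspaceD(2)[OF lin_subspace_component[of n]]
    by (auto simp: y0_def)
  have fs: "finsum fq.Q y (N - {n}) \<in> carrier fq.Q"
    using yN by (intro fq.Q.finsum_closed) auto
  have "z = y0 \<oplus>\<^bsub>fq.Q\<^esub> finsum fq.Q y (N - {n})"
  proof (cases "n \<in> N")
    case True
    then have "finsum fq.Q y (insert n (N - {n})) = y n \<oplus>\<^bsub>fq.Q\<^esub> finsum fq.Q y (N - {n})"
      using y(1) yN by (intro fq.Q.finsum_insert) auto
    then show ?thesis using True y(3) by (simp add: y0_def insert_absorb)
  next
    case False
    then show ?thesis using y(3) fs by (simp add: y0_def)
  qed
  then have "x \<oplus>\<^bsub>fq.Q\<^esub> z = (x \<oplus>\<^bsub>fq.Q\<^esub> y0) \<oplus>\<^bsub>fq.Q\<^esub> finsum fq.Q y (N - {n})"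
    using x y0 fs I_carrier by (simp add: fq.Q.a_assoc)
  also have "\<dots> = finsum fq.Q (y(n := x \<oplus>\<^bsub>fq.Q\<^esub> y0)) (insert n (N - {n}))"
  proof -
    have "finsum fq.Q (y(n := x \<oplus>\<^bsub>fq.Q\<^esub> y0)) (N - {n}) = finsum fq.Q y (N - {n})"
      using yN by (intro fq.Q.finsum_cong') (simp_all add: Pi_iff)
    then show ?thesis
      using y(1) yN x y0 I_carrier by (subst fq.Q.finsum_insert) simp_all
  qed
  finally have *: "x \<oplus>\<^bsub>fq.Q\<^esub> z = finsum fq.Q (y(n := x \<oplus>\<^bsub>fq.Q\<^esub> y0)) (insert n (N - {n}))" .
  have "x \<oplus>\<^bsub>fq.Q\<^esub> y0 \<in> I \<inter> lpa_component G n"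
    using fq.Q.alg_idealD(3)[OF I x(1) y0(1)]
      fq.Q.lin_subspaceD(3)[OF lin_subspace_component[of n] x(2) y0(2)] by blast
  then have "\<forall>m\<in>insert n (N - {n}). (y(n := x \<oplus>\<^bsub>fq.Q\<^esub> y0)) m \<in> I \<inter> lpa_component G m"
    using y(2) by auto
  moreover have "finite (insert n (N - {n}))" using y(1) by simp
  ultimately show ?thesis unfolding graded_sums_def mem_Collect_eq using * by (intro exI conjI)
qed

lemma hspan_graded_sums:
  assumes I: "alg_ideal fq.Q I" and "x \<in> hspan (fq.lift I)"
  shows "\<exists>f\<in>fq.F. x \<approx> f \<and> fq.proj f \<in> graded_sums I"
  using assms(2)
proof (induction rule: hspan.induct)
  case (kernel x)
  have "fq.proj 0 \<in> graded_sums I"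
    unfolding graded_sums_def fq.zero_Q[symmetric] by (auto intro!: exI[of _ "{}"])
  then show ?case
    using kernel by (intro bexI[of _ 0]) (auto simp: eqv_zero_iff free_alg_zero)
next
  case (step x n y)
  then obtain f g where f: "f \<in> fq.F" "x \<approx> f" "fq.proj f \<in> lpa_component G n"
    and g: "g \<in> fq.F" "y \<approx> g" "fq.proj g \<in> graded_sums I"
    using mspan_component by blast
  have "f \<in> fq.lift I"
    using eqv_mem[OF fq.two_sided_lift[OF I] fq.K'_subset_lift[OF I] f(2)] step(1) by blast
  then have "fq.proj f \<oplus>\<^bsub>fq.Q\<^esub> fq.proj g \<in> graded_sums I"
    using f g fq.lift_iff by (intro graded_sums_add[OF I]) auto
  then show ?case
    using f g by (intro bexI[of _ "f + g"]) (auto simp: fq.add_Q intro: free_alg_add eqv_add)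
qed

text \<open>Gaps are homogeneous of degree zero, so all generators are in
  \<open>hspan (fq.lift I)\<close>. This set is two-sided, hence its image contains all of
  \<open>I\<close>.\<close>

lemma graded_ideal_gen_gaps:
  assumes I: "alg_ideal L I" and gen: "I = ideal_gen L X"
    and X: "X \<subseteq> {lpa_gap G A S | A S. A \<in> gen_verts G \<and> finite S \<and> S \<subseteq> edges G}"
  shows "graded_ideal G I"
proof -
  note I' = I[unfolded L_eq]
  have "X \<subseteq> fq.proj ` (fq.F \<inter> hspan (fq.lift I))"
  proof
    fix x assume "x \<in> X"
    then obtain A S where AS: "A \<in> gen_verts G" "finite S" "S \<subseteq> edges G" and "x = lpa_gap G A S"
      using X by blast
    then have x: "x = fq.proj (gap A S)" using lpa_gap_eq by simp
    have "x \<in> I" unfolding gen by (rule subsetD[OF ideal_gen_superset \<open>x \<in> X\<close>])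
    then have "gap A S \<in> fq.lift I"
      using AS x gap_F fq.lift_iff by simp
    then have "gap A S + 0 \<in> hspan (fq.lift I)"
      using AS by (intro hspan.step[OF _ mspan_gap] hspan.kernel two_sided_zero[OF fq.two_sided_K'])
    then show "x \<in> fq.proj ` (fq.F \<inter> hspan (fq.lift I))"
      using AS x gap_F by simp
  qed
  then have sub: "I \<subseteq> fq.proj ` (fq.F \<inter> hspan (fq.lift I))"
    unfolding gen L_eq
    by (intro ideal_gen_least fq.alg_ideal_proj two_sided_hspan fq.two_sided_lift)
      (use I' gen in \<open>auto simp: L_eq\<close>)
  have "x \<in> graded_sums I" if "x \<in> I" for x
  proof -
    from that sub obtain f where f: "f \<in> fq.F" "f \<in> hspan (fq.lift I)" "x = fq.proj f" by blast
    obtain g where g: "g \<in> fq.F" "f \<approx> g" "fq.proj g \<in> graded_sums I"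
      using hspan_graded_sums[OF I' f(2)] by blast
    then show ?thesis using f fq.proj_eq_K'[of f g] by (simp add: eqv_def)
  qed
  then show ?thesis
    using I by (auto simp: graded_ideal_def Let_def graded_sums_def L_eq)
qed

text \<open>The canonical generators include \<open>lpa_p G {}\<close>, which is zero; a gap of the
  required form needs a vertex in \<open>A\<close>, so zero is discarded first.\<close>

lemma ideal_gen_minus_zero: "ideal_gen L (X - {\<zero>\<^bsub>L\<^esub>}) = ideal_gen L X"
proof -
  have "X - {\<zero>\<^bsub>L\<^esub>} \<subseteq> M \<longleftrightarrow> X \<subseteq> M" if "alg_ideal L M" for M
    using fq.Q.alg_idealD(2)[of M] that by (auto simp: L_eq)
  then show ?thesis by (auto simp: ideal_gen_def)
qed

lemma graded_gens_are_gaps: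
  fixes I :: "('v, 'e, 'k) lpa_elem set"
  shows "lpa_p G ` H_of G I \<union> lpa_pH G (H_of G I) ` S_of G I - {\<zero>\<^bsub>L\<^esub>} \<subseteq>
    {lpa_gap G A S | A S. A \<in> gen_verts G \<and> finite S \<and> S \<subseteq> edges G \<and>
      (\<exists>v\<in>A. \<forall>e\<in>S. src G e = v)}"
proof
  fix x assume x: "x \<in> lpa_p G ` H_of G I \<union> lpa_pH G (H_of G I) ` S_of G I - {\<zero>\<^bsub>L\<^esub>}"
  then consider A where "A \<in> H_of G I" "x = lpa_p G A"
    | v where "v \<in> S_of G I" "x = lpa_pH G (H_of G I) v" by blast
  then show "x \<in> {lpa_gap G A S | A S. A \<in> gen_verts G \<and> finite S \<and> S \<subseteq> edges G \<and>
      (\<exists>v\<in>A. \<forall>e\<in>S. src G e = v)}"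
  proof cases
    case 1
    then have A: "A \<in> gen_verts G" by (simp add: H_of_def)
    \<comment> \<open>For \<open>S = {}\<close> any vertex of \<open>A\<close> is a witness, so only
      nonemptiness matters; an empty \<open>A\<close> would make \<open>x\<close> the excluded
      zero.\<close>
    have "A \<noteq> {}"
    proof
      assume "A = {}"
      then have "x = fq.proj 0"
        using 1 p_empty fq.proj_eq_K'[of "p' {}" 0]
        by (auto simp: lpa_p_def lpa_gen_eq eqv_def free_alg_zero free_alg_var)
      then show False using x by (simp add: L_eq fq.zero_Q)
    qed
    moreover have "x = lpa_gap G A {}"
      using 1 lpa_gap_eq[OF A, of "{}"] by (simp add: gap_def edge_proj_def lpa_p_def lpa_gen_eq)
    ultimately show ?thesis using A by blast
  next
    case 2
    then have v: "v \<in> breaking G (H_of G I)" by (simp add: S_of_def)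
    show ?thesis
      using 2 v by (auto simp: lpa_pH_def breaking_def out_edges_def
          intro!: exI[of _ "{v}"] exI[of _ "{e \<in> edges G. src G e = v \<and> rng G e \<notin> H_of G I}"])
  qed
qed

end

theorem theorem2p5:
  fixes G :: "('v, 'e) ultragraph"
    and I :: "('v, 'e, 'k::field) lpa_elem set"
  assumes "ultragraph G"
    and "alg_ideal (LPA G) I"
  shows "(graded_ideal G I \<longleftrightarrow>
           (\<exists>X \<subseteq> {lpa_gap G A S | A S. A \<in> gen_verts G \<and> finite S \<and> S \<subseteq> edges G \<and>
                      (\<exists>v\<in>A. \<forall>e\<in>S. src G e = v)}.
              I = ideal_gen (LPA G) X))
       \<and> (graded_ideal G I \<longleftrightarrow>
           I = ideal_gen (LPA G)
                 (lpa_p G ` H_of G I \<union> lpa_pH G (H_of G I) ` S_of G I))"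
    (is "(_ \<longleftrightarrow> ?gaps) \<and> (_ \<longleftrightarrow> ?canonical)")
proof -
  interpret lpa_over G "TYPE('k)"
    using assms(1) by (simp add: lpa_over_def)
  let ?Y = "lpa_p G ` H_of G I \<union> lpa_pH G (H_of G I) ` S_of G I"
  \<comment> \<open>The equivalences follow from a cycle: graded, then canonical generators, then
    generation by gaps, then graded again.\<close>
  have "?canonical" if "graded_ideal G I"
  proof (rule antisym)
    show "I \<subseteq> ideal_gen (LPA G) ?Y" by (rule graded_ideal_subset[OF that])
    show "ideal_gen (LPA G) ?Y \<subseteq> I"
      by (rule ideal_gen_least[OF assms(2)]) (auto simp: H_of_def S_of_def)
  qed
  moreover have "?gaps" if "?canonical"
    using graded_gens_are_gaps that
    by (intro exI[of _ "?Y - {\<zero>\<^bsub>LPA G\<^esub>}"] conjI) (simp_all only: ideal_gen_minus_zero)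
  moreover have "graded_ideal G I" if "?gaps"
  proof -
    from that obtain X where "I = ideal_gen (LPA G) X"
      and "X \<subseteq> {lpa_gap G A S | A S. A \<in> gen_verts G \<and> finite S \<and> S \<subseteq> edges G \<and>
        (\<exists>v\<in>A. \<forall>e\<in>S. src G e = v)}"
      by (elim exE conjE)
    then show ?thesis by (intro graded_ideal_gen_gaps[OF assms(2)]) blast+
  qed
  ultimately show ?thesis by blast
qed

end
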